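(* For a given Type 2 second-order consensus network with an unweighted coupling graph $\mathcal G\in\mathbb G_n$, the performance measure $\rho_{ss}(A^{(2)}_{\mathcal G};M_n\oplus \mathbf 0)$ is bounded by $$\frac1\beta\left(\frac1{2n}-\frac1{2n^2}\right)\ \le\ \rho_{ss}(A^{(2)}_{\mathcal G};M_n\oplus \mathbf 0)\ <\ \Xi(n),$$ where $$\Xi(n)=\frac{(n^2-1)^2}{72\beta}-\frac{(n-1)(n-2)^2}{2n\beta}.$$ Moreover, the lower bound is achieved if and only if $\mathcal G=\mathcal K_n$.
   Context: Graphs are finite, simple and undirected; $\mathbb G_n$ is the class of all connected graphs with $n$ nodes, unweighted means all edge weights equal $1$, and $\mathcal K_n$ is the complete graph on $n$ nodes. $L_{\mathcal G}$ is the Laplacian of $\mathcal G$ (degree matrix minus adjacency matrix) with eigenvalues $0=\lambda_1\le\lambda_2\le\dots\le\lambda_n$, where $\lambda_2,\dots,\lambda_n$ are nonzero because $\mathcal G$ is connected. $M_n=I_n-\frac1nJ_n$ is the centering matrix ($J_n$ is the all-ones matrix). The Type 2 second-order consensus network over $\mathcal G$ is $\dot x=v$, $\dot v=-L_{\mathcal G}x-\beta L_{\mathcal G}v+\xi$, with design parameter $\beta>0$ and $\xi$ a zero-mean white stochastic process with identity covariance; $A^{(2)}_{\mathcal G}=\begin{bmatrix}\mathbf 0&-I\\ L_{\mathcal G}&\beta L_{\mathcal G}\end{bmatrix}$, so that the state $\psi=[x^{\mathrm T}\ v^{\mathrm T}]^{\mathrm T}$ satisfies $\dot\psi=-A^{(2)}_{\mathcal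 G}\psi+[\mathbf 0\ I]^{\mathrm T}\xi$. The performance measure is the steady-state variance $\lim_{t\to\infty}\mathbb E[y(t)^{\mathrm T}y(t)]$ of the output $y=M_nx$, which equals $\rho_{ss}(A^{(2)}_{\mathcal G};M_n\oplus\mathbf 0)=\frac1{2\beta}\sum_{i=2}^n\lambda_i^{-2}$.
   Formalization: The strict upper bound fails with equality for the paths on n = 1, 2, 3, 4 nodes; the formal theorem states ρ_ss ≤ Ξ(n) for all graphs and ρ_ss < Ξ(n) for every graph other than these four paths. *)

theory Defs
  imports "HOL-Probability.Probability" "Graph_Theory.Graph_Theory"
begin

hide_const (open) Digraph_Component.connected

text \<open>
  Simple undirected graphs are the symmetric loop-free graphs \<^locale>\<open>pair_graph\<close> of
  Graph_Theory, each undirected edge being the pair of its two orientations.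
  The node set is always all of the finite type \<open>'n\<close>.
\<close>

text \<open>The out-degree counts every incident edge once, so it is the undirected degree.\<close>

definition laplacian :: "'n::finite pair_pre_digraph \<Rightarrow> real^'n^'n" where
  "laplacian G = (\<chi> u v. (if u = v then real (out_degree (with_proj G) u) else 0)
                        - (if (u, v) \<in> parcs G then 1 else 0))"

definition path_graph :: "'n::finite pair_pre_digraph \<Rightarrow> bool" where
  "path_graph G \<longleftrightarrow>
     (\<exists>f::nat \<Rightarrow> 'n. bij_betw f {..<CARD('n)} UNIV \<and>
        (\<forall>i<CARD('n). \<forall>j<CARD('n). (f i, f j) \<in> parcs G \<longleftrightarrow> j = Suc i \<or> i = Suc j))"

definition centering_matrix :: "real^'n::finite^'n" where
  "centering_matrix = mat 1 - (1 / real CARD('n)) *\<^sub>R (\<chi> i j. 1)"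

definition block_matrix ::
    "real^'a::finite^'c::finite \<Rightarrow> real^'b::finite^'c \<Rightarrow> real^'a^'d::finite \<Rightarrow> real^'b^'d
      \<Rightarrow> real^('a + 'b)^('c + 'd)" where
  "block_matrix P Q R S =
     (\<chi> i j. case i of
        Inl k \<Rightarrow> (case j of Inl l \<Rightarrow> P $ k $ l | Inr l \<Rightarrow> Q $ k $ l)
      | Inr k \<Rightarrow> (case j of Inl l \<Rightarrow> R $ k $ l | Inr l \<Rightarrow> S $ k $ l))"

definition direct_sum ::
    "real^'a::finite^'c::finite \<Rightarrow> real^'b::finite^'d::finite \<Rightarrow> real^('a + 'b)^('c + 'd)" where
  "direct_sum P S = block_matrix P 0 0 S"

definition type2_state_matrix ::
    "'n::finite pair_pre_digraph \<Rightarrow> real \<Rightarrow> real^('n + 'n)^('n + 'n)" where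
  "type2_state_matrix G \<beta> = block_matrix 0 (- mat 1) (laplacian G) (\<beta> *\<^sub>R laplacian G)"

definition type2_input_matrix :: "real^'n::finite^('n + 'n)" where
  "type2_input_matrix =
     (\<chi> i j. case i of Inl k \<Rightarrow> 0 | Inr k \<Rightarrow> mat 1 $ k $ j)"

text \<open>
  White noise \<open>\<xi>\<close> with \<open>E \<xi> = 0\<close> and \<open>E \<xi>(s) \<xi>(t)\<^sup>T = \<delta>(s - t) I\<close> is a generalised process.
  It is represented by its primitive \<open>W(t) = \<integral>\<^sub>0\<^sup>t \<xi>\<close>, an ordinary process with
  \<open>E W = 0\<close> and \<open>E W(s) W(t)\<^sup>T = min s t I\<close>. Gaussianity is not required; a standard
  Brownian motion is one instance.
\<close>

definition integrated_white_noise ::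
    "'w measure \<Rightarrow> (real \<Rightarrow> 'w \<Rightarrow> real^'n::finite) \<Rightarrow> bool" where
  "integrated_white_noise M W \<longleftrightarrow>
     prob_space M \<and>
     (\<forall>t\<ge>0. W t \<in> borel_measurable M \<and> integrable M (\<lambda>\<omega>. (norm (W t \<omega>))\<^sup>2)) \<and>
     (AE \<omega> in M. continuous_on {0..} (\<lambda>t. W t \<omega>)) \<and>
     (\<forall>t\<ge>0. \<forall>i. (\<integral>\<omega>. W t \<omega> $ i \<partial>M) = 0) \<and>
     (\<forall>s\<ge>0. \<forall>t\<ge>0. \<forall>i j.
        (\<integral>\<omega>. W s \<omega> $ i * W t \<omega> $ j \<partial>M) = (if i = j then min s t else 0))"

text \<open>
  Solutions of \<open>\<psi>' = - A \<psi> + B \<xi>\<close>, read as the stochastic integral equation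
  \<open>\<psi>(t) = \<psi>(0) - \<integral>\<^sub>0\<^sup>t A \<psi>(s) ds + B W(t)\<close>. The noise is additive, so this makes sense
  path by path. The initial state is any square-integrable random vector.
\<close>

definition noisy_linear_system ::
    "'w measure \<Rightarrow> real^'k::finite^'k \<Rightarrow> real^'n::finite^'k \<Rightarrow> (real \<Rightarrow> 'w \<Rightarrow> real^'n)
      \<Rightarrow> (real \<Rightarrow> 'w \<Rightarrow> real^'k) \<Rightarrow> bool" where
  "noisy_linear_system M A B W \<psi> \<longleftrightarrow>
     integrated_white_noise M W \<and>
     (\<forall>t\<ge>0. \<psi> t \<in> borel_measurable M) \<and>
     integrable M (\<lambda>\<omega>. (norm (\<psi> 0 \<omega>))\<^sup>2) \<and>
     (AE \<omega> in M. continuous_on {0..} (\<lambda>t. \<psi> t \<omega>) \<and>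
        (\<forall>t\<ge>0. \<psi> t \<omega> = \<psi> 0 \<omega> - integral {0..t} (\<lambda>s. A *v \<psi> s \<omega>) + B *v W t \<omega>))"

definition type2_network ::
    "'w measure \<Rightarrow> 'n::finite pair_pre_digraph \<Rightarrow> real \<Rightarrow> (real \<Rightarrow> 'w \<Rightarrow> real^'n)
      \<Rightarrow> (real \<Rightarrow> 'w \<Rightarrow> real^('n + 'n)) \<Rightarrow> bool" where
  "type2_network M G \<beta> W \<psi> \<longleftrightarrow>
     noisy_linear_system M (type2_state_matrix G \<beta>) type2_input_matrix W \<psi>"

definition output_variance ::
    "'w measure \<Rightarrow> real^'k::finite^'m::finite \<Rightarrow> (real \<Rightarrow> 'w \<Rightarrow> real^'k) \<Rightarrow> real \<Rightarrow> real" where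
  "output_variance M C \<psi> t = (\<integral>\<omega>. (C *v \<psi> t \<omega>) \<bullet> (C *v \<psi> t \<omega>) \<partial>M)"

text \<open>
  \<open>steady_state_variance M (direct_sum centering_matrix 0) \<psi>\<close> is the steady-state variance of
  \<open>y = M\<^sub>n x\<close> for \<open>\<psi> = (x, v)\<close>: the output is then \<open>(y, 0)\<close>, whose squared norm is \<open>y\<^sup>T y\<close>.
  The value is meaningful only where \<open>output_variance\<close> converges.
\<close>

definition steady_state_variance ::
    "'w measure \<Rightarrow> real^'k::finite^'m::finite \<Rightarrow> (real \<Rightarrow> 'w \<Rightarrow> real^'k) \<Rightarrow> real" where
  "steady_state_variance M C \<psi> = Lim at_top (output_variance M C \<psi>)"

definition Xi :: "real \<Rightarrow> nat \<Rightarrow> real" where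
  "Xi \<beta> n = ((real n)\<^sup>2 - 1)\<^sup>2 / (72 * \<beta>)
            - (real n - 1) * (real n - 2)\<^sup>2 / (2 * real n * \<beta>)"

end

theory Submission
  imports Defs
begin

text \<open>
  Let \<open>q\<close> run over an orthonormal basis \<open>Q\<close> of the vectors of mean zero that consists of eigenvectors of
  the Laplacian, with eigenvalues \<open>\<lambda> > 0\<close>. Projected to \<open>q\<close>, the network is one damped oscillator with
  stiffness \<open>\<lambda>\<close> and damping \<open>\<beta> \<lambda>\<close>. Its transient decays, and the noise contributes in the limit the
  energy \<open>\<integral> h\<^sup>2 = 1 / (2 \<beta> \<lambda>\<^sup>2)\<close> of its impulse response \<open>h\<close>. Since centering removes the constant mode,
  the performance measure is \<open>(1 / (2 \<beta>)) \<Sum> \<lambda>\<^sup>-\<^sup>2\<close> (\<open>type2_output_variance_tendsto\<close>). What remains is to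
  bound the sum of the inverse squared eigenvalues of a connected graph on \<open>n\<close> vertices.

  Lower bound: \<open>n - \<lambda>\<close> is the value at \<open>q\<close> of the quadratic form of the complementary graph, so
  \<open>\<lambda> \<le> n\<close>, and if all eigenvalues equal \<open>n\<close> then no arc is missing
  (\<open>inverse_square_sum_minimal_iff\<close>).

  Upper bound: take a spanning tree. For each of its edges take the vertex set below it;
  let \<open>C\<close> be the Gram matrix of the centred indicator vectors of these sets. Summation by parts in the tree and
  Cauchy-Schwarz give \<open>\<Sum> \<lambda>\<^sup>-\<^sup>2 \<le> \<parallel>C\<parallel>\<^sup>2\<close> in the Frobenius norm (\<open>inverse_ev_le\<close>, \<open>mass_norm_sum_le\<close>).
  The norm is the squared trace of \<open>C\<close> minus the sum of its principal \<open>2 \<times> 2\<close> minors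
  (\<open>cut_gram_norm_eq\<close>). The trace is the Wiener index of the tree divided by \<open>n\<close>, which is at most
  \<open>(n\<^sup>2 - 1) / 6\<close>, the value for a path (\<open>cut_gram_trace_le\<close>). Two edges cut the tree into parts of sizes
  \<open>a\<close>, \<open>b\<close>, \<open>c\<close>, and their minor is \<open>a b c / n \<ge> (n - 2) / n\<close> (\<open>cut_minor_ge\<close>). There are \<open>(n - 1)(n - 2)\<close>
  ordered pairs of edges, which yields exactly the value of \<open>Xi\<close>.

  Equality would make all of these estimates sharp. Then the graph is its own spanning tree, the
  Wiener index is that of a path, so the graph is a path, and every two edges cut off two single
  vertices, which fails on a path with five or more vertices (\<open>inverse_square_sum_extremal\<close>).
\<close>

section \<open>Diagonalisation of self-adjoint maps\<close>

text \<open>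
  The first-order condition for a maximiser of the Rayleigh quotient: along any direction \<open>y\<close>
  orthogonal to \<open>x\<close> the quotient has no linear term.
\<close>

lemma quadratic_form_stationary:
  fixes f :: "'a::real_inner \<Rightarrow> 'a"
  assumes lin: "linear f" and sa: "\<And>x y. f x \<bullet> y = x \<bullet> f y"
    and max: "\<And>t. (x + t *\<^sub>R y) \<bullet> f (x + t *\<^sub>R y) \<le> \<mu> * ((x + t *\<^sub>R y) \<bullet> (x + t *\<^sub>R y))"
    and eq: "x \<bullet> f x = \<mu> * (x \<bullet> x)" and orth: "x \<bullet> y = 0"
  shows "f x \<bullet> y = 0"
proof (rule ccontr)
  assume neq: "f x \<bullet> y \<noteq> 0"
  \<comment> \<open>Moving by \<open>t = b / c\<close>, the linear gain \<open>2 t b\<close> exceeds the quadratic cost, which is at most \<open>t\<^sup>2 c\<close>.\<close>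
  define c where "c = \<bar>\<mu> * (y \<bullet> y) - y \<bullet> f y\<bar> + 1"
  define b where "b = f x \<bullet> y"
  have c: "c > 0" "\<mu> * (y \<bullet> y) - y \<bullet> f y < c" by (auto simp: c_def)
  have yx: "y \<bullet> x = 0" using orth by (simp add: inner_commute)
  have "2 * t * b \<le> t\<^sup>2 * (\<mu> * (y \<bullet> y) - y \<bullet> f y)" for t
  proof -
    have "x \<bullet> f y = b" "y \<bullet> f x = b" using sa[of x y] by (auto simp: b_def inner_commute)
    then show ?thesis
      using max[of t] eq
      by (simp add: linear_add[OF lin] linear_scale[OF lin] inner_add_left inner_add_right
          orth yx algebra_simps power2_eq_square)
  qed
  from this[of "b / c"] have "2 * (b / c) * b \<le> (b / c)\<^sup>2 * (\<mu> * (y \<bullet> y) - y \<bullet> f y)" .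
  also have "\<dots> \<le> (b / c)\<^sup>2 * c" using c by (intro mult_left_mono) auto
  also have "\<dots> = b * b / c" using c by (simp add: field_simps power2_eq_square)
  finally have "b * b / c \<le> 0" by simp
  moreover have "b * b / c > 0" using neq c by (simp add: b_def) (smt (verit) divide_pos_pos mult_neg_neg mult_pos_pos)
  ultimately show False by simp
qed

text \<open>
  On the compact unit sphere of \<open>S\<close> the quadratic form has a maximiser \<open>x\<close>. Stationarity makes
  \<open>f x\<close> orthogonal to the part of \<open>S\<close> orthogonal to \<open>x\<close>, and \<open>f x\<close> stays in \<open>S\<close>, so it is a
  multiple of \<open>x\<close>.
\<close>

lemma self_adjoint_eigenvector:
  fixes f :: "'a::euclidean_space \<Rightarrow> 'a"
  assumes lin: "linear f" and sa: "\<And>x y. f x \<bullet> y = x \<bullet> f y"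
    and S: "subspace S" "f ` S \<subseteq> S" "S \<noteq> {0}"
  shows "\<exists>x\<in>S. norm x = 1 \<and> f x = (x \<bullet> f x) *\<^sub>R x"
proof -
  define K where "K = S \<inter> sphere 0 1"
  have scale: "(1 / norm y) *\<^sub>R y \<in> K" if "y \<in> S" "y \<noteq> 0" for y
    using that S(1) by (auto simp: K_def subspace_scale)
  obtain y where "y \<in> S" "y \<noteq> 0" using S subspace_0 by blast
  then have "K \<noteq> {}" using scale by blast
  moreover have "compact K" unfolding K_def
    using S(1) by (simp add: closed_subspace closed_Int_compact)
  moreover have "continuous_on K (\<lambda>x. x \<bullet> f x)"
    by (intro continuous_intros linear_continuous_on linear_conv_bounded_linear[THEN iffD1] lin)
  ultimately obtain x where x: "x \<in> K" and max: "\<And>y. y \<in> K \<Longrightarrow> y \<bullet> f y \<le> x \<bullet> f x"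
    using continuous_attains_sup[of K "\<lambda>x. x \<bullet> f x"] by blast
  define \<mu> where "\<mu> = x \<bullet> f x"
  have xS: "x \<in> S" and nx: "norm x = 1" using x by (auto simp: K_def)
  have xx: "x \<bullet> x = 1" using nx by (simp add: dot_square_norm)
  have quad: "z \<bullet> f z \<le> \<mu> * (z \<bullet> z)" if "z \<in> S" for z
  proof (cases "z = 0")
    case False
    have "((1 / norm z) *\<^sub>R z) \<bullet> f ((1 / norm z) *\<^sub>R z) \<le> \<mu>"
      unfolding \<mu>_def by (rule max[OF scale[OF that False]])
    then have "(z \<bullet> f z) / (norm z)\<^sup>2 \<le> \<mu>"
      by (simp add: linear_scale[OF lin] power2_eq_square field_simps)
    then show ?thesis using False by (simp add: dot_square_norm field_simps)
  qed simp
  have stat: "f x \<bullet> y = 0" if "y \<in> S" "x \<bullet> y = 0" for y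
  proof (rule quadratic_form_stationary[where \<mu> = \<mu>, OF lin sa])
    show "(x + t *\<^sub>R y) \<bullet> f (x + t *\<^sub>R y) \<le> \<mu> * ((x + t *\<^sub>R y) \<bullet> (x + t *\<^sub>R y))" for t
      using quad S(1) xS that by (simp add: subspace_add subspace_scale)
  qed (use that xx in \<open>auto simp: \<mu>_def\<close>)
  define r where "r = f x - \<mu> *\<^sub>R x"
  have "r \<in> S" using S(1,2) xS by (auto simp: r_def subspace_diff subspace_scale)
  moreover have "x \<bullet> r = 0" by (simp add: r_def inner_diff_right \<mu>_def xx)
  ultimately have "f x \<bullet> r = 0" by (rule stat)
  with \<open>x \<bullet> r = 0\<close> have "r \<bullet> r = 0" by (simp add: r_def inner_diff_left)
  then have "f x = (x \<bullet> f x) *\<^sub>R x" by (simp add: r_def \<mu>_def)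
  then show ?thesis using xS nx by blast
qed

text \<open>
  Split off one eigenvector; self-adjointness keeps its orthogonal complement in \<open>S\<close> invariant,
  so induction on the dimension applies. Working inside an invariant subspace is what
  lets the Laplacian be diagonalised on the vectors of mean zero alone. The eigenvalue of \<open>q\<close> is
  written as its Rayleigh quotient, so no separate eigenvalue function is needed.
\<close>

theorem self_adjoint_eigenbasis:
  fixes f :: "'a::euclidean_space \<Rightarrow> 'a"
  assumes lin: "linear f" and sa: "\<And>x y. f x \<bullet> y = x \<bullet> f y"
    and "subspace S" "f ` S \<subseteq> S"
  shows "\<exists>B. B \<subseteq> S \<and> span B = S \<and> pairwise orthogonal B \<and>
    (\<forall>q\<in>B. norm q = 1 \<and> f q = (q \<bullet> f q) *\<^sub>R q)"
  using assms(3,4)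
proof (induction "dim S" arbitrary: S rule: less_induct)
  case less
  show ?case
  proof (cases "S = {0}")
    case True
    then show ?thesis by (intro exI[of _ "{}"]) simp
  next
    case False
    obtain x where x: "x \<in> S" "norm x = 1" "f x = (x \<bullet> f x) *\<^sub>R x"
      using self_adjoint_eigenvector[OF lin sa less.prems False] by blast
    have xx: "x \<bullet> x = 1" using x(2) by (simp add: dot_square_norm)
    define T where "T = {y \<in> S. x \<bullet> y = 0}"
    have T: "subspace T" using less.prems(1)
      by (auto simp: T_def subspace_def inner_add_right)
    have "x \<notin> T" using xx by (simp add: T_def)
    moreover have "T \<subseteq> S" by (auto simp: T_def)
    ultimately have "T \<subset> S" using x(1) by blast
    then have "span T \<subset> span S"
      using T less.prems(1) by (simp add: span_eq_iff[THEN iffD2])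
    then have "dim T < dim S" by (rule dim_psubset)
    moreover have "f ` T \<subseteq> T"
    proof
      fix z assume "z \<in> f ` T"
      then obtain y where y: "y \<in> S" "x \<bullet> y = 0" "z = f y" by (auto simp: T_def)
      have "x \<bullet> f y = ((x \<bullet> f x) *\<^sub>R x) \<bullet> y" using sa[of x y] x(3) by metis
      also have "\<dots> = 0" by (simp add: y(2))
      finally show "z \<in> T" using y less.prems(2) by (auto simp: T_def)
    qed
    ultimately obtain B where B: "B \<subseteq> T" "span B = T" "pairwise orthogonal B"
      "\<And>q. q \<in> B \<Longrightarrow> norm q = 1 \<and> f q = (q \<bullet> f q) *\<^sub>R q"
      using less.hyps[OF _ T] by blast
    have "span (insert x B) = S"
    proof
      show "span (insert x B) \<subseteq> S"
        using B(1) x(1) less.prems(1) by (intro span_minimal) (auto simp: T_def)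
      show "S \<subseteq> span (insert x B)"
      proof
        fix y assume "y \<in> S"
        then have "y - (x \<bullet> y) *\<^sub>R x \<in> T"
          using x(1) less.prems(1) xx
          by (auto simp: T_def subspace_diff subspace_scale inner_diff_right)
        then show "y \<in> span (insert x B)"
          by (subst span_insert) (auto simp: B(2))
      qed
    qed
    moreover have "pairwise orthogonal (insert x B)"
      using B(1,3) by (auto simp: pairwise_insert orthogonal_def T_def inner_commute)
    ultimately show ?thesis
      using x B(1,4) \<open>T \<subset> S\<close> by (intro exI[of _ "insert x B"]) blast
  qed
qed

lemma orthonormal_expansion:
  fixes B :: "'a::euclidean_space set"
  assumes "pairwise orthogonal B" "\<And>q. q \<in> B \<Longrightarrow> norm q = 1" "x \<in> span B"
  shows "x = (\<Sum>q\<in>B. (q \<bullet> x) *\<^sub>R q)"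
proof -
  have "0 \<notin> B" using assms(2) by force
  then have "finite B"
    using assms(1) by (intro finiteI_independent pairwise_orthogonal_independent)
  from orthonormal_basis_expand[OF assms this] show ?thesis by (simp add: inner_commute)
qed

lemma orthonormal_parseval:
  fixes B :: "'a::euclidean_space set"
  assumes "pairwise orthogonal B" "\<And>q. q \<in> B \<Longrightarrow> norm q = 1" "x \<in> span B"
  shows "x \<bullet> y = (\<Sum>q\<in>B. (q \<bullet> x) * (q \<bullet> y))"
  by (subst orthonormal_expansion[OF assms]) (simp_all add: inner_sum_left)

section \<open>Rooted trees and their cut sizes\<close>

text \<open>
  The closed form of \<open>\<Sum>k=1..m. k * (N - k)\<close>. For \<open>m = N - 1\<close> and equally for \<open>m = N\<close> it is the Wiener index of
  the path on \<open>N\<close> vertices: its edges cut off \<open>1, 2, \<dots>, N - 1\<close> vertices.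
\<close>

definition path_cut_sum :: "real \<Rightarrow> real \<Rightarrow> real" where
  "path_cut_sum N m = m * (m + 1) * (3 * N - 2 * m - 1) / 6"

lemma path_cut_sum_0 [simp]: "path_cut_sum N 0 = 0"
  by (simp add: path_cut_sum_def)

lemma path_cut_sum_step: "path_cut_sum N m + (1 + m) * (N - (1 + m)) = path_cut_sum N (1 + m)"
  by (simp add: path_cut_sum_def field_simps)

text \<open>
  The correction term is positive for \<open>a, b > 0\<close> and \<open>a + b < N - 1\<close>: two branches side by side give
  smaller cuts than the same vertices in one branch. It vanishes for
  \<open>a + b = N - 1\<close>, since a path may be rooted at an interior vertex.
\<close>

lemma path_cut_sum_add:
  "path_cut_sum N (a + b) = path_cut_sum N a + path_cut_sum N b + a * b * (N - 1 - (a + b))"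
  by (simp add: path_cut_sum_def field_simps)

lemma path_cut_sum_superadditive:
  assumes "finite C" "\<And>c. c \<in> C \<Longrightarrow> 0 \<le> h c" "sum h C \<le> N - 1"
  shows "(\<Sum>c\<in>C. path_cut_sum N (h c)) \<le> path_cut_sum N (sum h C)"
  using assms
proof (induction C rule: finite_induct)
  case (insert c C)
  have nn: "0 \<le> h c" "0 \<le> sum h C" using insert.prems(1) by (auto intro: sum_nonneg)
  then have le: "sum h C \<le> N - 1" using insert.prems(2) insert.hyps by simp
  have "0 \<le> h c * sum h C * (N - 1 - (h c + sum h C))"
    using nn insert.prems(2) insert.hyps by (intro mult_nonneg_nonneg) auto
  moreover have "(\<Sum>c\<in>C. path_cut_sum N (h c)) \<le> path_cut_sum N (sum h C)"
    using insert.prems(1) le by (intro insert.IH) auto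
  ultimately show ?case
    using insert.hyps by (simp add: path_cut_sum_add)
qed simp

lemma path_cut_sum_strictly_superadditive:
  assumes C: "finite C" "\<And>c. c \<in> C \<Longrightarrow> 0 < h c" "sum h C < N - 1"
    and two: "c \<in> C" "d \<in> C" "c \<noteq> d"
  shows "(\<Sum>c\<in>C. path_cut_sum N (h c)) < path_cut_sum N (sum h C)"
proof -
  define C' where "C' = C - {c}"
  have C': "C = insert c C'" "c \<notin> C'" "finite C'" "d \<in> C'" using C two by (auto simp: C'_def)
  have "0 < h c" "0 < sum h C'" using C(2) C' by (auto intro!: sum_pos)
  moreover from this have "sum h C' \<le> N - 1" using C(3) C' by simp
  ultimately have "0 < h c * sum h C' * (N - 1 - (h c + sum h C'))"
    using C(3) C' by (intro mult_pos_pos) auto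
  moreover have "(\<Sum>c\<in>C'. path_cut_sum N (h c)) \<le> path_cut_sum N (sum h C')"
    using C(2) C' \<open>sum h C' \<le> N - 1\<close> by (intro path_cut_sum_superadditive) (auto simp: less_imp_le)
  ultimately show ?thesis using C' by (simp add: path_cut_sum_add)
qed

text \<open>
  The bound for the sum of the inverse squared nonzero Laplacian eigenvalues on \<open>N\<close> vertices: the
  squared sum of the inverse eigenvalues of a path, minus a lower bound for twice the second elementary symmetric
  polynomial of the inverse eigenvalues of a tree.
\<close>

definition path_bound :: "real \<Rightarrow> real" where
  "path_bound N = ((N\<^sup>2 - 1) / 6)\<^sup>2 - (N - 1) * (N - 2)\<^sup>2 / N"

text \<open>
  A tree structure on all of the finite type \<open>'n\<close>. The root is its own parent, so that \<open>parent\<close> can be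
  iterated freely; \<open>depth\<close> excludes cycles.
\<close>

locale rooted_tree =
  fixes root :: "'n::finite" and parent :: "'n \<Rightarrow> 'n" and depth :: "'n \<Rightarrow> nat"
  assumes parent_root: "parent root = root"
    and depth_root: "depth root = 0"
    and depth_parent: "\<And>v. v \<noteq> root \<Longrightarrow> depth v = Suc (depth (parent v))"
begin

definition desc :: "'n \<Rightarrow> 'n set" where
  "desc v = {u. \<exists>k. (parent ^^ k) u = v}"

definition children :: "'n \<Rightarrow> 'n set" where
  "children v = {c. c \<noteq> root \<and> parent c = v}"

abbreviation subsize :: "'n \<Rightarrow> real" where
  "subsize v \<equiv> real (card (desc v))"

lemma desc_refl [simp]: "v \<in> desc v"
  by (auto simp: desc_def intro: exI[of _ 0])

lemma desc_iff: "u \<in> desc v \<longleftrightarrow> u = v \<or> parent u \<in> desc v"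
proof
  assume "u \<in> desc v"
  then obtain k where k: "(parent ^^ k) u = v" by (auto simp: desc_def)
  show "u = v \<or> parent u \<in> desc v"
  proof (cases k)
    case (Suc j)
    then have "(parent ^^ j) (parent u) = v" using k by (metis comp_apply funpow_Suc_right)
    then show ?thesis by (auto simp: desc_def)
  qed (use k in simp)
next
  assume "u = v \<or> parent u \<in> desc v"
  moreover have "u \<in> desc v" if "(parent ^^ k) (parent u) = v" for k
    using that by (auto simp: desc_def funpow_swap1 intro: exI[of _ "Suc k"])
  ultimately show "u \<in> desc v" by (auto simp: desc_def intro: exI[of _ 0])
qed

lemma desc_trans: "u \<in> desc v \<Longrightarrow> v \<in> desc w \<Longrightarrow> u \<in> desc w"
  unfolding desc_def by (auto simp flip: funpow_add comp_apply[of "parent ^^ _" "parent ^^ _"])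

lemma desc_laminar:
  assumes "u \<in> desc v" "u \<in> desc w"
  shows "v \<in> desc w \<or> w \<in> desc v"
proof -
  obtain i j where ij: "(parent ^^ i) u = v" "(parent ^^ j) u = w"
    using assms by (auto simp: desc_def)
  have shift: "(parent ^^ (b - a)) ((parent ^^ a) u) = (parent ^^ b) u" if "a \<le> b" for a b
    using that by (simp flip: comp_apply[of "parent ^^ _" "parent ^^ _"] funpow_add)
  show ?thesis
    using shift[of i j] shift[of j i] ij by (cases "i \<le> j") (auto simp: desc_def)
qed

lemma depth_0_iff: "depth v = 0 \<longleftrightarrow> v = root"
  using depth_parent depth_root by force

lemma depth_funpow: "depth ((parent ^^ k) u) = depth u - k"
proof (induction k)
  case (Suc k)
  show ?case
  proof (cases "(parent ^^ k) u = root")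
    case True
    then show ?thesis using Suc by (simp add: parent_root depth_root)
  next
    case False
    then show ?thesis using Suc depth_parent[OF False] by simp
  qed
qed simp

lemma desc_root: "desc root = UNIV"
proof -
  have "(parent ^^ depth u) u = root" for u
    using depth_funpow[of "depth u" u] depth_0_iff by simp
  then show ?thesis by (auto simp: desc_def)
qed

lemma depth_desc_less:
  assumes "u \<in> desc v" "u \<noteq> v"
  shows "depth v < depth u"
proof -
  obtain k where k: "(parent ^^ k) u = v" using assms by (auto simp: desc_def)
  have "k \<noteq> 0" using k assms(2) by (metis funpow_0)
  moreover have "depth u \<noteq> 0"
  proof
    assume "depth u = 0"
    then have "u = root" by (simp add: depth_0_iff)
    moreover have "(parent ^^ k) root = root" by (induction k) (auto simp: parent_root)
    ultimately show False using k assms(2) by simp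
  qed
  ultimately show ?thesis using depth_funpow[of k u] k by simp
qed

lemma desc_antisym: "u \<in> desc v \<Longrightarrow> v \<in> desc u \<Longrightarrow> u = v"
  using depth_desc_less by (metis less_asym)

lemma root_in_desc_iff: "root \<in> desc v \<longleftrightarrow> v = root"
  using depth_desc_less[of root v] depth_root by auto

lemma desc_psubset: "u \<in> desc v \<Longrightarrow> u \<noteq> v \<Longrightarrow> desc u \<subset> desc v"
  using desc_trans desc_antisym by (metis desc_refl psubsetI subsetI)

lemma desc_decomp: "desc v = insert v (\<Union>c\<in>children v. desc c)"
proof -
  have "\<exists>c\<in>children v. u \<in> desc c" if "u \<in> desc v" "u \<noteq> v" for u
    using that
  proof (induction "depth u" arbitrary: u rule: less_induct)
    case less
    have u: "u \<noteq> root" using less.prems by (auto simp: root_in_desc_iff)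
    show ?case
    proof (cases "parent u = v")
      case True
      then show ?thesis using u by (intro bexI[of _ u]) (auto simp: children_def)
    next
      case False
      then have "\<exists>c\<in>children v. parent u \<in> desc c"
        using less.prems depth_parent[OF u] desc_iff[of u v] by (intro less.hyps) auto
      then show ?thesis using desc_iff[of u] by blast
    qed
  qed
  moreover have "desc c \<subseteq> desc v" if "c \<in> children v" for c
    using that desc_trans[of _ c v] desc_iff[of c v] by (auto simp: children_def)
  ultimately show ?thesis by auto
qed

lemma not_desc_child: "c \<in> children v \<Longrightarrow> v \<notin> desc c"
  using depth_desc_less[of v c] depth_parent[of c] by (force simp: children_def)

lemma desc_children_disjoint:
  assumes "c \<in> children v" "d \<in> children v" "c \<noteq> d"
  shows "desc c \<inter> desc d = {}"
proof -
  have "\<not> a \<in> desc b" if "a \<in> children v" "b \<in> children v" "a \<noteq> b" for a b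
    using that depth_desc_less[of a b] depth_parent[of a] depth_parent[of b]
    by (force simp: children_def)
  then show ?thesis using desc_laminar assms by blast
qed

lemma sum_desc:
  fixes f :: "'n \<Rightarrow> real"
  shows "sum f (desc v) = f v + (\<Sum>c\<in>children v. sum f (desc c))"
proof -
  have "sum f (desc v) = f v + sum f (\<Union>c\<in>children v. desc c)"
    by (subst desc_decomp) (auto simp: not_desc_child)
  also have "sum f (\<Union>c\<in>children v. desc c) = (\<Sum>c\<in>children v. sum f (desc c))"
    by (intro sum.UNION_disjoint) (auto dest: desc_children_disjoint)
  finally show ?thesis .
qed

lemma subsize_decomp: "subsize v = 1 + (\<Sum>c\<in>children v. subsize c)"
  using sum_desc[of "\<lambda>_. 1" v] by simp

lemma subsize_pos: "0 < subsize v"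
  using desc_refl[of v] by (auto simp: card_gt_0_iff simp del: desc_refl)

lemma subsize_le: "subsize v \<le> real CARD('n)"
  by (simp add: card_mono)

lemma subsize_less:
  assumes "u \<in> desc v" "u \<noteq> v"
  shows "subsize u + 1 \<le> subsize v"
proof -
  have "card (desc u) < card (desc v)" using desc_psubset[OF assms] by (intro psubset_card_mono) auto
  then show ?thesis by linarith
qed

lemma subsize_less_order: "v \<noteq> root \<Longrightarrow> subsize v + 1 \<le> real CARD('n)"
  using subsize_less[of v root] by (simp add: desc_root)

text \<open>
  An edge between \<open>u\<close> and its parent separates the descendants of \<open>u\<close> from the other vertices, so at the root this is the
  Wiener index, the sum of all distances in the tree. The root itself contributes \<open>0\<close>.
\<close>

definition cut_sum :: "'n \<Rightarrow> real" where
  "cut_sum v = (\<Sum>u\<in>desc v. subsize u * (real CARD('n) - subsize u))"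

lemma cut_sum_decomp:
  "cut_sum v = (\<Sum>c\<in>children v. cut_sum c) + subsize v * (real CARD('n) - subsize v)"
  unfolding cut_sum_def by (subst sum_desc) simp

lemma path_cut_sum_children:
  "path_cut_sum (real CARD('n)) (\<Sum>c\<in>children v. subsize c) + subsize v * (real CARD('n) - subsize v)
     = path_cut_sum (real CARD('n)) (subsize v)"
  unfolding subsize_decomp[of v] by (rule path_cut_sum_step)

lemma children_total: "(\<Sum>c\<in>children v. subsize c) \<le> real CARD('n) - 1"
  using subsize_decomp[of v] subsize_le[of v] by linarith

text \<open>
  Induction from the leaves upwards. By superadditivity the subtrees below the
  children of \<open>v\<close> can be replaced by a single path, and \<open>v\<close> extends that path by one vertex.
\<close>

lemma cut_sum_le: "cut_sum v \<le> path_cut_sum (real CARD('n)) (subsize v)"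
proof (induction "card (desc v)" arbitrary: v rule: less_induct)
  case less
  have "(\<Sum>c\<in>children v. cut_sum c) \<le> (\<Sum>c\<in>children v. path_cut_sum (real CARD('n)) (subsize c))"
  proof (intro sum_mono less)
    fix c assume "c \<in> children v"
    then have "c \<in> desc v" "c \<noteq> v"
      using desc_iff[of c v] not_desc_child[of c v] by (auto simp: children_def)
    then show "card (desc c) < card (desc v)" using subsize_less[of c v] by simp
  qed
  also have "\<dots> \<le> path_cut_sum (real CARD('n)) (\<Sum>c\<in>children v. subsize c)"
    by (intro path_cut_sum_superadditive children_total) auto
  finally show ?case
    using cut_sum_decomp[of v] path_cut_sum_children[of v] by linarith
qed

text \<open>
  Two branches below \<open>v\<close> comprise at most \<open>CARD('n) - 2\<close> vertices, because neither \<open>v\<close> nor the root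
  belongs to them. This makes superadditivity strict.
\<close>

lemma cut_sum_less_branching:
  assumes "v \<noteq> root" "c \<in> children v" "d \<in> children v" "c \<noteq> d"
  shows "cut_sum v < path_cut_sum (real CARD('n)) (subsize v)"
proof -
  have "(\<Sum>c\<in>children v. cut_sum c) \<le> (\<Sum>c\<in>children v. path_cut_sum (real CARD('n)) (subsize c))"
    by (intro sum_mono cut_sum_le)
  also have "\<dots> < path_cut_sum (real CARD('n)) (\<Sum>c\<in>children v. subsize c)"
    using assms subsize_decomp[of v] subsize_less_order[of v]
    by (intro path_cut_sum_strictly_superadditive[where c = c and d = d] subsize_pos) auto
  finally show ?thesis
    using cut_sum_decomp[of v] path_cut_sum_children[of v] by linarith
qed

lemma cut_sum_less_root:
  assumes "cut_sum v < path_cut_sum (real CARD('n)) (subsize v)"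
  shows "cut_sum root < path_cut_sum (real CARD('n)) (subsize root)"
  using assms
proof (induction "depth v" arbitrary: v)
  case 0
  then show ?case by (simp add: depth_0_iff)
next
  case (Suc k)
  then have v: "v \<noteq> root" using depth_root by auto
  have "(\<Sum>c\<in>children (parent v). cut_sum c)
      < (\<Sum>c\<in>children (parent v). path_cut_sum (real CARD('n)) (subsize c))"
    using v Suc.prems by (intro sum_strict_mono_ex1) (auto simp: cut_sum_le children_def)
  also have "\<dots> \<le> path_cut_sum (real CARD('n)) (\<Sum>c\<in>children (parent v). subsize c)"
    by (intro path_cut_sum_superadditive children_total) auto
  finally have "cut_sum (parent v) < path_cut_sum (real CARD('n)) (subsize (parent v))"
    using cut_sum_decomp[of "parent v"] path_cut_sum_children[of "parent v"] by linarith
  moreover have "k = depth (parent v)" using Suc.hyps(2) depth_parent[OF v] by simp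
  ultimately show ?case using Suc.hyps(1) by blast
qed

text \<open>
  The Gram matrix of the centred indicator vectors of the descendant sets. Over the
  non-root vertices, seen as edges to the parent, it is the inverse of the edge Gram matrix
  \<open>B\<^sup>T B\<close> of the tree with incidence matrix \<open>B\<close>, so its spectrum consists of the inverse
  nonzero Laplacian eigenvalues of the tree.
\<close>

definition cut_gram :: "'n \<Rightarrow> 'n \<Rightarrow> real" where
  "cut_gram v w = real (card (desc v \<inter> desc w)) - subsize v * subsize w / real CARD('n)"

lemma card_vertices_pos: "0 < real CARD('n)"
  by simp

lemma cut_gram_diag: "cut_gram v v = subsize v * (real CARD('n) - subsize v) / real CARD('n)"
  by (simp add: cut_gram_def field_simps)

lemma cut_gram_commute: "cut_gram v w = cut_gram w v"
  by (simp add: cut_gram_def Int_commute mult.commute)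

lemma cut_gram_trace:
  "(\<Sum>v\<in>-{root}. cut_gram v v) = cut_sum root / real CARD('n)"
proof -
  have "(\<Sum>v\<in>-{root}. cut_gram v v) = (\<Sum>v\<in>UNIV. cut_gram v v)"
    by (intro sum.mono_neutral_left) (auto simp: cut_gram_diag desc_root)
  then show ?thesis
    by (simp add: cut_sum_def desc_root cut_gram_diag sum_divide_distrib)
qed

lemma path_cut_sum_card: "path_cut_sum (real CARD('n)) (real CARD('n)) / real CARD('n) = ((real CARD('n))\<^sup>2 - 1) / 6"
  by (simp add: path_cut_sum_def field_simps power2_eq_square)

text \<open>
  Among all trees the path has the largest Wiener index \<open>n (n\<^sup>2 - 1) / 6\<close>.
\<close>

lemma cut_gram_trace_le: "(\<Sum>v\<in>-{root}. cut_gram v v) \<le> ((real CARD('n))\<^sup>2 - 1) / 6"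
  using cut_sum_le[of root] divide_right_mono[of "cut_sum root" "path_cut_sum (real CARD('n)) (real CARD('n))" "real CARD('n)"]
  by (simp add: cut_gram_trace desc_root flip: path_cut_sum_card)

lemma cut_gram_trace_less:
  assumes "v \<noteq> root" "c \<in> children v" "d \<in> children v" "c \<noteq> d"
  shows "(\<Sum>v\<in>-{root}. cut_gram v v) < ((real CARD('n))\<^sup>2 - 1) / 6"
  using cut_sum_less_root[OF cut_sum_less_branching[OF assms]]
    divide_strict_right_mono[of "cut_sum root" "path_cut_sum (real CARD('n)) (real CARD('n))" "real CARD('n)"]
  by (simp add: cut_gram_trace desc_root flip: path_cut_sum_card)

text \<open>
  Two distinct edges cut the tree into three parts of sizes \<open>a\<close>, \<open>b\<close>, \<open>c\<close>, and the principal
  minor of \<open>cut_gram\<close> at these two edges equals \<open>a b c / (a + b + c)\<close>. The two lemmas below are the two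
  relative positions of the edges.
\<close>

definition cut_minor :: "'n \<Rightarrow> 'n \<Rightarrow> real" where
  "cut_minor v w = cut_gram v v * cut_gram w w - (cut_gram v w)\<^sup>2"

lemma cut_minor_nested:
  assumes "w \<in> desc v"
  shows "cut_minor v w = subsize w * (subsize v - subsize w) * (real CARD('n) - subsize v) / real CARD('n)"
proof -
  have "desc v \<inter> desc w = desc w" using assms desc_trans by blast
  then have "cut_gram v w = subsize w * (real CARD('n) - subsize v) / real CARD('n)"
    by (simp add: cut_gram_def field_simps)
  then show ?thesis
    using card_vertices_pos unfolding cut_minor_def cut_gram_diag
    by (simp only: power2_eq_square) (simp add: field_simps)
qed

lemma cut_minor_disjoint:
  assumes "desc v \<inter> desc w = {}"
  shows "cut_minor v w = subsize v * subsize w * (real CARD('n) - subsize v - subsize w) / real CARD('n)"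
  using card_vertices_pos assms
  by (simp add: cut_minor_def cut_gram_def field_simps power2_eq_square)

lemma product_of_three_ge:
  fixes a b c :: real
  assumes "1 \<le> a" "1 \<le> b" "1 \<le> c"
  shows "a + b + c - 2 \<le> a * b * c"
proof -
  have "0 \<le> (a - 1) * (b - 1)" "0 \<le> (a * b - 1) * (c - 1)"
    using assms mult_mono[of 1 a 1 b] by (auto intro!: mult_nonneg_nonneg)
  then show ?thesis by (simp add: algebra_simps)
qed

text \<open>
  The least product of three positive integers with a given sum \<open>n\<close> is \<open>n - 2\<close>, attained when two of
  them are \<open>1\<close>.
\<close>

lemma cut_minor_ge:
  assumes "v \<noteq> root" "w \<noteq> root" "v \<noteq> w"
  shows "(real CARD('n) - 2) / real CARD('n) \<le> cut_minor v w"
proof -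
  have nested: "(real CARD('n) - 2) / real CARD('n) \<le> cut_minor v w"
    if "v \<noteq> root" "v \<noteq> w" "w \<in> desc v" for v w
    using product_of_three_ge[of "subsize w" "subsize v - subsize w" "real CARD('n) - subsize v"]
      subsize_pos[of w] subsize_less[of w v] subsize_less_order[of v] that
    by (auto simp: cut_minor_nested intro!: divide_right_mono)
  consider "w \<in> desc v" | "v \<in> desc w" | "desc v \<inter> desc w = {}"
    using desc_laminar by blast
  then show ?thesis
  proof cases
    case 2
    then show ?thesis using nested[of w v] assms
      by (simp add: cut_minor_def cut_gram_commute mult.commute)
  next
    case 3
    have "card (desc v) + card (desc w) = card (desc v \<union> desc w)"
      using 3 by (simp add: card_Un_disjoint)
    also have "\<dots> < CARD('n)"
    proof (rule psubset_card_mono)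
      have "root \<notin> desc v \<union> desc w" using assms by (simp add: root_in_desc_iff)
      then show "desc v \<union> desc w \<subset> UNIV" by blast
    qed simp
    finally show ?thesis
      using product_of_three_ge[of "subsize v" "subsize w" "real CARD('n) - subsize v - subsize w"]
        subsize_pos[of v] subsize_pos[of w]
      by (auto simp: cut_minor_disjoint[OF 3] intro!: divide_right_mono)
  qed (use nested assms in auto)
qed

abbreviation cut_gram_norm :: real where
  "cut_gram_norm \<equiv> (\<Sum>v\<in>-{root}. \<Sum>w\<in>-{root}. (cut_gram v w)\<^sup>2)"

abbreviation edge_pairs :: "('n \<times> 'n) set" where
  "edge_pairs \<equiv> {(v, w). v \<noteq> root \<and> w \<noteq> root \<and> v \<noteq> w}"

text \<open>
  The squared Frobenius norm is the squared trace minus all principal \<open>2 \<times> 2\<close> minors. This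
  turns a lower bound for the minors into an upper bound for the norm.
\<close>

lemma cut_gram_norm_eq:
  "cut_gram_norm = (\<Sum>v\<in>-{root}. cut_gram v v)\<^sup>2 - (\<Sum>(v, w)\<in>edge_pairs. cut_minor v w)"
proof -
  have "(\<Sum>v\<in>-{root}. cut_gram v v)\<^sup>2 - cut_gram_norm
      = (\<Sum>v\<in>-{root}. \<Sum>w\<in>-{root}. cut_minor v w)"
    by (simp add: power2_eq_square sum_product cut_minor_def sum_subtractf)
  also have "\<dots> = (\<Sum>(v, w)\<in>(-{root}) \<times> (-{root}). cut_minor v w)"
    by (rule sum.cartesian_product)
  also have "\<dots> = (\<Sum>(v, w)\<in>edge_pairs. cut_minor v w)"
    by (intro sum.mono_neutral_right) (auto simp: cut_minor_def power2_eq_square)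
  finally show ?thesis by simp
qed

lemma card_edge_pairs: "real (card edge_pairs) = (real CARD('n) - 1) * (real CARD('n) - 2)"
proof -
  have "edge_pairs = (SIGMA v:-{root}. - {root, v})" by auto
  then have "card edge_pairs = (\<Sum>v\<in>-{root}. card (- {root, v}))" by (simp add: card_SigmaI)
  also have "\<dots> = (\<Sum>v\<in>-{root}. CARD('n) - 2)"
    by (intro sum.cong) (auto simp: Compl_eq_Diff_UNIV card_Diff_subset)
  finally have c: "card edge_pairs = (CARD('n) - 1) * (CARD('n) - 2)" by (simp add: Compl_eq_Diff_UNIV card_Diff_subset)
  have "CARD('n) \<ge> 1" by (simp add: Suc_leI)
  then consider "CARD('n) = 1" | "CARD('n) \<ge> 2" by linarith
  then show ?thesis by cases (simp_all add: c of_nat_diff)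
qed

lemma cut_gram_trace_nonneg: "0 \<le> (\<Sum>v\<in>-{root}. cut_gram v v)"
  using subsize_le by (intro sum_nonneg) (auto simp: cut_gram_diag)

lemma minor_total:
  "(real CARD('n) - 1) * (real CARD('n) - 2)\<^sup>2 / real CARD('n) = (\<Sum>(v, w)\<in>edge_pairs. (real CARD('n) - 2) / real CARD('n))"
  by (simp add: card_edge_pairs case_prod_beta power2_eq_square)

lemma minor_total_le:
  "(real CARD('n) - 1) * (real CARD('n) - 2)\<^sup>2 / real CARD('n) \<le> (\<Sum>(v, w)\<in>edge_pairs. cut_minor v w)"
  unfolding minor_total by (intro sum_mono) (auto intro: cut_minor_ge)

theorem cut_gram_norm_le: "cut_gram_norm \<le> path_bound (real CARD('n))"
  using power_mono[OF cut_gram_trace_le cut_gram_trace_nonneg, of 2] minor_total_le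
  unfolding cut_gram_norm_eq path_bound_def by linarith

text \<open>
  Equality forces both estimates to be sharp: the Wiener index must be that of a path, and
  every two edges must cut off two single vertices.
\<close>

theorem cut_gram_norm_eq_path_bound:
  assumes "cut_gram_norm = path_bound (real CARD('n))"
  shows "v \<noteq> root \<Longrightarrow> c \<in> children v \<Longrightarrow> d \<in> children v \<Longrightarrow> c = d"
    and "(v, w) \<in> edge_pairs \<Longrightarrow> cut_minor v w = (real CARD('n) - 2) / real CARD('n)"
proof -
  show "c = d" if "v \<noteq> root" "c \<in> children v" "d \<in> children v"
  proof (rule ccontr)
    assume "c \<noteq> d"
    then have "(\<Sum>v\<in>-{root}. cut_gram v v)\<^sup>2 < (((real CARD('n))\<^sup>2 - 1) / 6)\<^sup>2"
      using that cut_gram_trace_nonneg by (intro power_strict_mono cut_gram_trace_less) auto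
    then show False
      using assms minor_total_le unfolding cut_gram_norm_eq path_bound_def by linarith
  qed
  show "cut_minor v w = (real CARD('n) - 2) / real CARD('n)" if vw: "(v, w) \<in> edge_pairs"
  proof (rule ccontr)
    assume "cut_minor v w \<noteq> (real CARD('n) - 2) / real CARD('n)"
    moreover have "(real CARD('n) - 2) / real CARD('n) \<le> cut_minor v w" using vw by (auto intro: cut_minor_ge)
    ultimately have "(real CARD('n) - 2) / real CARD('n) < cut_minor v w" by simp
    then have "(real CARD('n) - 1) * (real CARD('n) - 2)\<^sup>2 / real CARD('n) < (\<Sum>(v, w)\<in>edge_pairs. cut_minor v w)"
      unfolding minor_total using vw
      by (intro sum_strict_mono_ex1) (auto intro: cut_minor_ge)
    then show False
      using assms power_mono[OF cut_gram_trace_le cut_gram_trace_nonneg, of 2]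
      unfolding cut_gram_norm_eq path_bound_def by linarith
  qed
qed

lemma inj_depth:
  assumes one: "\<And>v c d. c \<in> children v \<Longrightarrow> d \<in> children v \<Longrightarrow> c = d"
  shows "inj depth"
proof (rule injI)
  fix u w assume "depth u = depth w"
  then show "u = w"
  proof (induction "depth u" arbitrary: u w)
    case 0
    then show ?case using depth_0_iff by metis
  next
    case (Suc k)
    then have nr: "u \<noteq> root" "w \<noteq> root" using depth_root by (metis Zero_not_Suc)+
    then have "parent u = parent w"
      using Suc depth_parent[of u] depth_parent[of w] by (intro Suc.hyps(1)) auto
    then show ?case using nr by (intro one[of u "parent u" w]) (auto simp: children_def)
  qed
qed

lemma bij_depth:
  assumes "inj depth"
  shows "bij_betw depth UNIV {..<CARD('n)}"
proof -
  have "k \<in> range depth" if "k \<le> depth u" for k u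
    using depth_funpow[of "depth u - k" u] that by (intro image_eqI[of _ _ "(parent ^^ (depth u - k)) u"]) auto
  then have "{..depth u} \<subseteq> range depth" for u by blast
  then have "card {..depth u} \<le> card (range depth)" for u by (intro card_mono) auto
  then have "depth u < CARD('n)" for u
    using card_image[OF assms] by (simp add: Suc_le_eq)
  then have "range depth \<subseteq> {..<CARD('n)}" by auto
  then have "range depth = {..<CARD('n)}"
    using card_image[OF assms] by (intro card_subset_eq) auto
  then show ?thesis using assms by (simp add: bij_betw_def)
qed

text \<open>
  On a path with at least five vertices, the second and the third edge from an end cut it into
  parts of sizes \<open>2\<close>, \<open>1\<close> and \<open>n - 3\<close>, whose product exceeds \<open>n - 2\<close>.
\<close>

lemma path_card_le_4:
  assumes inj: "inj depth" and eq: "cut_gram_norm = path_bound (real CARD('n))"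
  shows "CARD('n) \<le> 4"
proof (rule ccontr)
  assume "\<not> CARD('n) \<le> 4"
  then have N: "CARD('n) \<ge> 5" by simp
  note bij = bij_depth[OF inj]
  have desc: "desc v = depth -` {depth v..<CARD('n)}" for v
  proof -
    have "u \<in> desc v" if "depth v \<le> depth u" for u
    proof -
      have "depth ((parent ^^ (depth u - depth v)) u) = depth v"
        using that by (simp add: depth_funpow)
      then show ?thesis using inj by (auto simp: desc_def inj_def)
    qed
    moreover have "depth v \<le> depth u" if "u \<in> desc v" for u
      using depth_desc_less[OF that] by (cases "u = v") auto
    moreover have "depth u < CARD('n)" for u using bij by (auto simp: bij_betw_def)
    ultimately show ?thesis by auto
  qed
  have size: "card (desc v) = CARD('n) - depth v" for v
  proof -
    have "card (depth ` desc v) = card (desc v)" using inj by (meson card_image inj_on_subset subset_UNIV)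
    moreover have "depth ` desc v = {depth v..<CARD('n)}"
      unfolding desc using bij by (auto simp: bij_betw_def image_vimage_eq)
    ultimately show ?thesis by simp
  qed
  have "2 \<in> range depth" "3 \<in> range depth" using bij N by (auto simp: bij_betw_def)
  then obtain v w where vw: "depth v = 2" "depth w = 3" by (metis rangeE)
  have "w \<in> desc v" using vw N by (auto simp: desc)
  moreover have "(v, w) \<in> edge_pairs" using vw depth_root by auto
  ultimately have "subsize w * (subsize v - subsize w) * (real CARD('n) - subsize v) / real CARD('n) = (real CARD('n) - 2) / real CARD('n)"
    using cut_gram_norm_eq_path_bound(2)[OF eq, of v w] cut_minor_nested[of w v] by simp
  then show False using N by (simp add: size vw of_nat_diff)
qed

end

section \<open>The Laplacian of a connected graph\<close>

text \<open>
  The hypotheses on the coupling graph. They make \<open>parcs G\<close> a symmetric, irreflexive relation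
  on \<open>'n\<close> that connects all vertices.
\<close>

locale connected_network =
  fixes G :: "'n::finite pair_pre_digraph"
  assumes graph: "pair_graph G" and verts: "pverts G = UNIV"
    and conn: "Digraph_Component.connected (with_proj G)"
begin

sublocale pair_graph G by (rule graph)

lemma arc_sym: "(u, v) \<in> parcs G \<Longrightarrow> (v, u) \<in> parcs G"
  using sym_arcs by (auto simp: symmetric_def sym_def)

lemma arc_reachable: "(u, v) \<in> (parcs G)\<^sup>*"
proof -
  have "u \<rightarrow>\<^sup>*\<^bsub>with_proj (mk_symmetric (with_proj G))\<^esub> v"
    using conn verts unfolding connected_def strongly_connected_def by simp
  then have "u \<rightarrow>\<^sup>*\<^bsub>with_proj G\<^esub> v"
    using reachable_mk_symmetric_eq[OF sym_arcs] by simp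
  then show ?thesis
    unfolding reachable_def using rtrancl_on_rtranclI verts by simp
qed

lemma sum_arcs_swap:
  fixes f :: "'n \<Rightarrow> 'n \<Rightarrow> real"
  shows "(\<Sum>(u, v)\<in>parcs G. f u v) = (\<Sum>(u, v)\<in>parcs G. f v u)"
  by (rule sum.reindex_bij_witness[of _ prod.swap prod.swap]) (auto dest: arc_sym)

lemma laplacian_mult: "(laplacian G *v x) $ u = (\<Sum>v | (u, v) \<in> parcs G. x $ u - x $ v)"
proof -
  have "out_arcs (with_proj G) u = Pair u ` {v. (u, v) \<in> parcs G}"
    by (auto simp: out_arcs_def)
  then have deg: "out_degree (with_proj G) u = card {v. (u, v) \<in> parcs G}"
    by (simp add: out_degree_def card_image inj_on_def)
  have "(laplacian G *v x) $ u
      = (\<Sum>v\<in>UNIV. (if u = v then real (out_degree (with_proj G) u) * x $ v else 0)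
          - (if (u, v) \<in> parcs G then x $ v else 0))"
    by (simp add: laplacian_def matrix_vector_mult_def left_diff_distrib if_distrib[of "\<lambda>y. y * _"]
        cong: if_cong)
  also have "\<dots> = real (card {v. (u, v) \<in> parcs G}) * x $ u - (\<Sum>v | (u, v) \<in> parcs G. x $ v)"
    by (simp add: sum_subtractf deg sum.If_cases)
  finally show ?thesis by (simp add: sum_subtractf)
qed

text \<open>
  Every undirected edge occurs in \<open>parcs G\<close> in both orientations, hence the factor \<open>1 / 2\<close>.
\<close>

lemma laplacian_form:
  "x \<bullet> (laplacian G *v y) = (\<Sum>(u, v)\<in>parcs G. (x $ u - x $ v) * (y $ u - y $ v)) / 2"
proof -
  have "x \<bullet> (laplacian G *v y) = (\<Sum>u\<in>UNIV. \<Sum>v | (u, v) \<in> parcs G. x $ u * (y $ u - y $ v))"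
    by (simp add: inner_vec_def laplacian_mult sum_distrib_left)
  also have "\<dots> = (\<Sum>(u, v)\<in>parcs G. x $ u * (y $ u - y $ v))"
    by (subst sum.Sigma) (auto intro!: sum.cong)
  finally have 1: "x \<bullet> (laplacian G *v y) = (\<Sum>(u, v)\<in>parcs G. x $ u * (y $ u - y $ v))" .
  moreover have "\<dots> = (\<Sum>(u, v)\<in>parcs G. x $ v * (y $ v - y $ u))"
    by (rule sum_arcs_swap)
  moreover have "(\<Sum>(u, v)\<in>parcs G. (x $ u - x $ v) * (y $ u - y $ v))
      = (\<Sum>(u, v)\<in>parcs G. x $ u * (y $ u - y $ v)) + (\<Sum>(u, v)\<in>parcs G. x $ v * (y $ v - y $ u))"
    by (simp add: case_prod_beta algebra_simps flip: sum.distrib)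
  ultimately show ?thesis by simp
qed

lemma laplacian_self_adjoint: "(laplacian G *v x) \<bullet> y = x \<bullet> (laplacian G *v y)"
  by (simp add: laplacian_form inner_commute[of _ y] mult.commute)

lemma laplacian_orthogonal_ones: "1 \<bullet> (laplacian G *v x) = 0"
  by (simp add: laplacian_form)

lemma laplacian_quadratic: "x \<bullet> (laplacian G *v x) = (\<Sum>(u, v)\<in>parcs G. (x $ u - x $ v)\<^sup>2) / 2"
  by (simp add: laplacian_form power2_eq_square)

text \<open>
  If the quadratic form vanishes then \<open>x\<close> agrees along every arc, so by connectedness it is
  constant, and a constant vector of mean zero is zero.
\<close>

lemma laplacian_pos:
  assumes "1 \<bullet> x = 0" "x \<noteq> 0"
  shows "0 < x \<bullet> (laplacian G *v x)"
proof (rule ccontr)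
  assume "\<not> 0 < x \<bullet> (laplacian G *v x)"
  moreover have "0 \<le> (\<Sum>(u, v)\<in>parcs G. (x $ u - x $ v)\<^sup>2)" by (intro sum_nonneg) auto
  ultimately have "(\<Sum>(u, v)\<in>parcs G. (x $ u - x $ v)\<^sup>2) = 0" by (simp add: laplacian_quadratic)
  then have "\<forall>(u, v)\<in>parcs G. x $ u = x $ v" by (subst (asm) sum_nonneg_eq_0_iff) auto
  then have edge: "x $ u = x $ v" if "(u, v) \<in> parcs G" for u v using that by auto
  have const: "x $ u = x $ v" for u v
    using arc_reachable[of u v] by (induction rule: rtrancl_induct) (auto dest: edge)
  have "real CARD('n) * x $ u = 0" for u
  proof -
    have "(\<Sum>v\<in>UNIV. x $ v) = (\<Sum>v\<in>(UNIV :: 'n set). x $ u)" by (intro sum.cong const) simp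
    then show ?thesis using assms(1) by (simp add: inner_vec_def)
  qed
  then show False using assms(2) by (simp add: vec_eq_iff)
qed

lemma laplacian_eigenbasis:
  "\<exists>Q. pairwise orthogonal Q \<and> (\<forall>q\<in>Q. norm q = 1) \<and> span Q = {x. 1 \<bullet> x = 0} \<and>
    (\<forall>q\<in>Q. laplacian G *v q = (q \<bullet> (laplacian G *v q)) *\<^sub>R q)"
proof -
  have "subspace {x :: real^'n. 1 \<bullet> x = 0}" by (rule subspace_hyperplane)
  moreover have "(\<lambda>x. laplacian G *v x) ` {x. 1 \<bullet> x = 0} \<subseteq> {x. 1 \<bullet> x = 0}"
    by (auto simp: laplacian_orthogonal_ones)
  ultimately obtain B where "B \<subseteq> {x :: real^'n. 1 \<bullet> x = 0}" "span B = {x. 1 \<bullet> x = 0}" "pairwise orthogonal B"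
    "\<forall>q\<in>B. norm q = 1 \<and> laplacian G *v q = (q \<bullet> (laplacian G *v q)) *\<^sub>R q"
    using self_adjoint_eigenbasis[of "\<lambda>x. laplacian G *v x" "{x. 1 \<bullet> x = 0}",
        OF matrix_vector_mul_linear laplacian_self_adjoint] by blast
  then show ?thesis by blast
qed

text \<open>
  Joining every vertex to a neighbour one step closer to the root gives a spanning tree whose
  depth is the distance from the root.
\<close>

lemma bfs_tree:
  fixes root :: 'n
  shows "\<exists>parent depth. rooted_tree root parent depth \<and> (\<forall>v. v \<noteq> root \<longrightarrow> (v, parent v) \<in> parcs G)"
proof -
  define depth where "depth v = (LEAST k. (root, v) \<in> parcs G ^^ k)" for v
  have ex: "\<exists>k. (root, v) \<in> parcs G ^^ k" for v
    using arc_reachable[of root v] by (simp add: rtrancl_power)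
  have walk: "(root, v) \<in> parcs G ^^ depth v" for v
    unfolding depth_def using ex[of v] by (rule LeastI_ex)
  have shortest: "depth v \<le> k" if "(root, v) \<in> parcs G ^^ k" for v k
    unfolding depth_def using that by (rule Least_le)
  have step: "\<exists>u. (v, u) \<in> parcs G \<and> depth v = Suc (depth u)" if v: "v \<noteq> root" for v
  proof -
    have "depth v \<noteq> 0" using walk[of v] v by (metis relpow_0_E)
    then obtain j where j: "depth v = Suc j" using not0_implies_Suc by blast
    then obtain u where u: "(root, u) \<in> parcs G ^^ j" "(u, v) \<in> parcs G"
      using walk[of v] by auto
    have "depth v \<le> Suc (depth u)" using walk[of u] u(2) by (intro shortest) auto
    then have "depth u = j" using shortest[OF u(1)] j by simp
    then show ?thesis using u(2) j arc_sym by blast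
  qed
  define parent where "parent v = (if v = root then root else SOME u. (v, u) \<in> parcs G \<and> depth v = Suc (depth u))" for v
  have parent: "(v, parent v) \<in> parcs G \<and> depth v = Suc (depth (parent v))" if "v \<noteq> root" for v
    using someI_ex[OF step[OF that]] that by (simp add: parent_def)
  have "depth root = 0" using shortest[of root 0] by simp
  then have "rooted_tree root parent depth"
    using parent by unfold_locales (auto simp: parent_def)
  then show ?thesis using parent by blast
qed

end

text \<open>
  \<open>Q\<close> is an orthonormal eigenbasis of the vectors of mean zero. The remaining eigenvector of
  the Laplacian is the constant one, with eigenvalue \<open>0\<close>.
\<close>

locale diagonalised_network = connected_network G for G :: "'n::finite pair_pre_digraph" +
  fixes Q :: "(real^'n) set"
  assumes orth: "pairwise orthogonal Q" and unit: "\<And>q. q \<in> Q \<Longrightarrow> norm q = 1"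
    and span_Q: "span Q = {x. 1 \<bullet> x = 0}"
    and eig: "\<And>q. q \<in> Q \<Longrightarrow> laplacian G *v q = (q \<bullet> (laplacian G *v q)) *\<^sub>R q"
begin

abbreviation ev :: "real^'n \<Rightarrow> real" where
  "ev q \<equiv> q \<bullet> (laplacian G *v q)"

lemma inner_self: "q \<in> Q \<Longrightarrow> q \<bullet> q = 1"
  using unit by (simp add: dot_square_norm)

lemma sum_zero: "q \<in> Q \<Longrightarrow> (\<Sum>u\<in>UNIV. q $ u) = 0"
  using span_base[of q Q] span_Q by (simp add: inner_vec_def)

lemma nonzero: "q \<in> Q \<Longrightarrow> q \<noteq> 0"
  using unit by force

lemma ev_pos: "q \<in> Q \<Longrightarrow> 0 < ev q"
  using span_base[of q Q] span_Q nonzero by (intro laplacian_pos) auto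

lemma independent_Q: "independent Q"
  using orth nonzero by (intro pairwise_orthogonal_independent) auto

lemma finite_Q: "finite Q"
  using independent_Q by (rule finiteI_independent)

lemma card_Q: "real (card Q) = real CARD('n) - 1"
proof -
  have "card Q = dim {x :: real^'n. 1 \<bullet> x = 0}"
    using independent_Q span_Q span_superset[of Q] by (intro basis_card_eq_dim) auto
  also have "\<dots> = CARD('n) - 1"
    using dim_hyperplane[of "1 :: real^'n"] by simp
  finally show ?thesis by (simp add: of_nat_diff Suc_leI)
qed

text \<open>
  The eigenvectors in \<open>Q\<close> detect every pair of vertices. Hence an arc, or a missing arc, that
  contributes nothing to the quadratic form of any eigenvector cannot exist. Both
  equality cases rest on this.
\<close>

lemma separated:
  assumes "a \<noteq> b"
  shows "\<exists>q\<in>Q. q $ a \<noteq> q $ b"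
proof (rule ccontr)
  assume eq: "\<not> (\<exists>q\<in>Q. q $ a \<noteq> q $ b)"
  define x :: "real^'n" where "x = axis a 1 - axis b 1"
  have "x \<in> span Q" by (simp add: x_def span_Q inner_diff_right inner_axis)
  then have "x \<bullet> x = (\<Sum>q\<in>Q. (q \<bullet> x) * (q \<bullet> x))" by (intro orthonormal_parseval orth unit)
  also have "\<dots> = 0" using eq by (intro sum.neutral) (auto simp: x_def inner_diff_right inner_axis)
  finally have "x $ a = 0" by simp
  then show False using assms by (simp add: x_def axis_def)
qed

text \<open>
  The quadratic form of the complete graph is \<open>n\<close> times the squared norm on vectors of mean zero, so
  the defect \<open>n - ev q\<close> is the quadratic form of the complementary graph.
\<close>

lemma ev_complement:
  assumes "q \<in> Q"
  shows "real CARD('n) - ev q = (\<Sum>(u, v)\<in>- parcs G. (q $ u - q $ v)\<^sup>2) / 2"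
proof -
  have norm: "(\<Sum>v\<in>UNIV. (q $ v)\<^sup>2) = 1"
    using inner_self[OF assms] by (simp add: inner_vec_def power2_eq_square)
  have "(\<Sum>v\<in>UNIV. (q $ u - q $ v)\<^sup>2) = real CARD('n) * (q $ u)\<^sup>2 + 1" for u
  proof -
    have "(\<Sum>v\<in>UNIV. (q $ u - q $ v)\<^sup>2)
        = (\<Sum>v\<in>(UNIV :: 'n set). (q $ u)\<^sup>2) + (\<Sum>v\<in>UNIV. (q $ v)\<^sup>2) - 2 * q $ u * (\<Sum>v\<in>UNIV. q $ v)"
      by (simp only: power2_diff sum_subtractf sum.distrib sum_distrib_left)
    then show ?thesis using norm sum_zero[OF assms] by simp
  qed
  then have "(\<Sum>(u, v)\<in>UNIV. (q $ u - q $ v)\<^sup>2) = (\<Sum>u\<in>UNIV. real CARD('n) * (q $ u)\<^sup>2 + 1)"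
    by (simp flip: UNIV_Times_UNIV sum.cartesian_product)
  also have "\<dots> = 2 * real CARD('n)"
    using norm by (simp add: sum.distrib flip: sum_distrib_left)
  finally have "(\<Sum>(u, v)\<in>UNIV. (q $ u - q $ v)\<^sup>2) = 2 * real CARD('n)" .
  moreover have "(\<Sum>(u, v)\<in>UNIV. (q $ u - q $ v)\<^sup>2)
      = (\<Sum>(u, v)\<in>- parcs G. (q $ u - q $ v)\<^sup>2) + (\<Sum>(u, v)\<in>parcs G. (q $ u - q $ v)\<^sup>2)"
    using sum.subset_diff[of "parcs G" UNIV] by (simp add: Compl_eq_Diff_UNIV)
  ultimately show ?thesis by (simp add: laplacian_quadratic)
qed

lemma ev_le: "q \<in> Q \<Longrightarrow> ev q \<le> real CARD('n)"
  using ev_complement[of q] sum_nonneg[of "- parcs G" "\<lambda>(u, v). (q $ u - q $ v)\<^sup>2"] by auto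

lemma all_ev_maximal_iff:
  "(\<forall>q\<in>Q. ev q = real CARD('n)) \<longleftrightarrow> parcs G = {(u, v). u \<noteq> v}"
proof
  assume ev: "\<forall>q\<in>Q. ev q = real CARD('n)"
  have "(a, b) \<in> parcs G" if ab: "a \<noteq> b" for a b
  proof (rule ccontr)
    assume "(a, b) \<notin> parcs G"
    moreover obtain q where q: "q \<in> Q" "q $ a \<noteq> q $ b" using separated[OF ab] by blast
    ultimately have "0 < (\<Sum>(u, v)\<in>- parcs G. (q $ u - q $ v)\<^sup>2)"
      by (intro sum_pos2[of _ "(a, b)"]) auto
    then show False using ev_complement[OF q(1)] ev q(1) by simp
  qed
  then show "parcs G = {(u, v). u \<noteq> v}" using no_loops' by auto
next
  assume E: "parcs G = {(u, v). u \<noteq> v}"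
  show "\<forall>q\<in>Q. ev q = real CARD('n)"
  proof
    fix q assume q: "q \<in> Q"
    have "(\<Sum>(u, v)\<in>- parcs G. (q $ u - q $ v)\<^sup>2) = 0" by (intro sum.neutral) (auto simp: E)
    then show "ev q = real CARD('n)" using ev_complement[OF q] by simp
  qed
qed

abbreviation inverse_square_sum :: real where
  "inverse_square_sum \<equiv> (\<Sum>q\<in>Q. 1 / (ev q)\<^sup>2)"

lemma complete_total: "(real CARD('n) - 1) / (real CARD('n))\<^sup>2 = (\<Sum>q\<in>Q. 1 / (real CARD('n))\<^sup>2)"
  by (simp add: card_Q)

lemma inverse_square_le: "q \<in> Q \<Longrightarrow> 1 / (real CARD('n))\<^sup>2 \<le> 1 / (ev q)\<^sup>2"
  using ev_le[of q] ev_pos[of q] power_mono[of "ev q" "real CARD('n)" 2]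
  by (intro divide_left_mono mult_pos_pos) auto

theorem inverse_square_sum_ge: "(real CARD('n) - 1) / (real CARD('n))\<^sup>2 \<le> inverse_square_sum"
  unfolding complete_total by (intro sum_mono inverse_square_le)

theorem inverse_square_sum_minimal_iff:
  "inverse_square_sum = (real CARD('n) - 1) / (real CARD('n))\<^sup>2 \<longleftrightarrow> parcs G = {(u, v). u \<noteq> v}"
proof -
  have "ev q = real CARD('n)" if eq: "inverse_square_sum = (\<Sum>q\<in>Q. 1 / (real CARD('n))\<^sup>2)" and q: "q \<in> Q" for q
  proof -
    have "1 / (real CARD('n))\<^sup>2 = 1 / (ev q)\<^sup>2"
      by (rule sum_mono_inv[OF eq[symmetric] inverse_square_le q finite_Q])
    then have "(ev q)\<^sup>2 = (real CARD('n))\<^sup>2" by simp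
    then show ?thesis by (rule power2_eq_imp_eq) (use ev_pos[OF q] in auto)
  qed
  then show ?thesis unfolding complete_total all_ev_maximal_iff[symmetric] by auto
qed

end

section \<open>Comparison with a spanning tree\<close>

text \<open>
  Writing \<open>P\<close> for the matrix with entries \<open>\<Sum>v\<in>V. s i v * s j v\<close>: its squared diagonal is at most
  its squared Frobenius norm, and \<open>S S\<^sup>T\<close> and \<open>S\<^sup>T S\<close> have the same Frobenius norm.
\<close>

lemma gram_sum_squares_le:
  fixes s :: "'i \<Rightarrow> 'v \<Rightarrow> real"
  assumes "finite I"
  shows "(\<Sum>i\<in>I. (\<Sum>v\<in>V. (s i v)\<^sup>2)\<^sup>2) \<le> (\<Sum>v\<in>V. \<Sum>w\<in>V. (\<Sum>i\<in>I. s i v * s i w)\<^sup>2)"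
proof -
  have square: "(\<Sum>a\<in>A. f a)\<^sup>2 = (\<Sum>(a, b)\<in>A \<times> A. f a * f b)" for f :: "'c \<Rightarrow> real" and A
    by (simp add: power2_eq_square sum_product sum.cartesian_product)
  have "(\<Sum>i\<in>I. (\<Sum>v\<in>V. (s i v)\<^sup>2)\<^sup>2) \<le> (\<Sum>i\<in>I. \<Sum>j\<in>I. (\<Sum>v\<in>V. s i v * s j v)\<^sup>2)"
  proof (rule sum_mono)
    fix i assume "i \<in> I"
    then have "(\<Sum>v\<in>V. s i v * s i v)\<^sup>2 \<le> (\<Sum>j\<in>I. (\<Sum>v\<in>V. s i v * s j v)\<^sup>2)"
      using assms by (intro member_le_sum[of i I "\<lambda>j. (\<Sum>v\<in>V. s i v * s j v)\<^sup>2"]) auto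
    then show "(\<Sum>v\<in>V. (s i v)\<^sup>2)\<^sup>2 \<le> (\<Sum>j\<in>I. (\<Sum>v\<in>V. s i v * s j v)\<^sup>2)"
      by (simp add: power2_eq_square)
  qed
  also have "\<dots> = (\<Sum>(i, j)\<in>I \<times> I. (\<Sum>v\<in>V. s i v * s j v)\<^sup>2)"
    by (rule sum.cartesian_product)
  also have "\<dots> = (\<Sum>(i, j)\<in>I \<times> I. \<Sum>(v, w)\<in>V \<times> V. s i v * s j v * (s i w * s j w))"
    by (simp add: square)
  also have "\<dots> = (\<Sum>(v, w)\<in>V \<times> V. \<Sum>(i, j)\<in>I \<times> I. s i v * s j v * (s i w * s j w))"
    unfolding case_prod_beta by (rule sum.swap)
  also have "\<dots> = (\<Sum>(v, w)\<in>V \<times> V. (\<Sum>i\<in>I. s i v * s i w)\<^sup>2)"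
    by (simp add: square mult.commute mult.left_commute)
  also have "\<dots> = (\<Sum>v\<in>V. \<Sum>w\<in>V. (\<Sum>i\<in>I. s i v * s i w)\<^sup>2)"
    by (rule sum.cartesian_product[symmetric])
  finally show ?thesis .
qed

text \<open>
  The tree need not be named as a subgraph: every vertex other than the root stands for its
  edge to the parent.
\<close>

locale network_spanning_tree = diagonalised_network G Q + rooted_tree root parent depth
  for G :: "'n::finite pair_pre_digraph" and Q and root :: 'n and parent and depth +
  assumes parent_arc: "\<And>v. v \<noteq> root \<Longrightarrow> (v, parent v) \<in> parcs G"
begin

definition edge_drop :: "real^'n \<Rightarrow> 'n \<Rightarrow> real" where
  "edge_drop q v = q $ v - q $ parent v"

definition desc_mass :: "real^'n \<Rightarrow> 'n \<Rightarrow> real" where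
  "desc_mass q v = (\<Sum>u\<in>desc v. q $ u)"

definition tree_arcs :: "('n \<times> 'n) set" where
  "tree_arcs = (\<lambda>v. (v, parent v)) ` (-{root}) \<union> (\<lambda>v. (parent v, v)) ` (-{root})"

lemma tree_arcs_subset: "tree_arcs \<subseteq> parcs G"
  using parent_arc arc_sym by (auto simp: tree_arcs_def)

lemma sum_tree_arcs: "(\<Sum>(u, v)\<in>tree_arcs. (q $ u - q $ v)\<^sup>2) = 2 * (\<Sum>v\<in>-{root}. (edge_drop q v)\<^sup>2)"
proof -
  have "(\<lambda>v. (v, parent v)) ` (-{root}) \<inter> (\<lambda>v. (parent v, v)) ` (-{root}) = {}"
  proof -
    have False if "v \<noteq> root" "w \<noteq> root" "parent v = w" "parent w = v" for v w
      using depth_parent[of v] depth_parent[of w] that by simp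
    then show ?thesis by blast
  qed
  then have "(\<Sum>(u, v)\<in>tree_arcs. (q $ u - q $ v)\<^sup>2)
      = (\<Sum>(u, v)\<in>(\<lambda>v. (v, parent v)) ` (-{root}). (q $ u - q $ v)\<^sup>2)
        + (\<Sum>(u, v)\<in>(\<lambda>v. (parent v, v)) ` (-{root}). (q $ u - q $ v)\<^sup>2)"
    unfolding tree_arcs_def by (intro sum.union_disjoint) auto
  also have "\<dots> = 2 * (\<Sum>v\<in>-{root}. (edge_drop q v)\<^sup>2)"
    by (simp add: sum.reindex inj_on_def edge_drop_def power2_commute)
  finally show ?thesis .
qed

text \<open>
  The tree edges contribute the squared drops; the remaining arcs only increase the form. This
  replaces the monotonicity of eigenvalues under adding edges.
\<close>

lemma ev_split:
  "q \<bullet> (laplacian G *v q) = (\<Sum>v\<in>-{root}. (edge_drop q v)\<^sup>2) + (\<Sum>(u, v)\<in>parcs G - tree_arcs. (q $ u - q $ v)\<^sup>2) / 2"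
  using sum.subset_diff[OF tree_arcs_subset, of "\<lambda>(u, v). (q $ u - q $ v)\<^sup>2"]
  by (simp add: laplacian_quadratic sum_tree_arcs add_divide_distrib)

lemma edge_drops_le: "(\<Sum>v\<in>-{root}. (edge_drop q v)\<^sup>2) \<le> q \<bullet> (laplacian G *v q)"
proof -
  have "0 \<le> (\<Sum>(u, v)\<in>parcs G - tree_arcs. (q $ u - q $ v)\<^sup>2)" by (intro sum_nonneg) auto
  then show ?thesis by (simp add: ev_split)
qed

text \<open>
  The edges on the path from \<open>u\<close> to the root are those of the vertices that have \<open>u\<close> as a descendant.
\<close>

lemma telescope: "q $ u - q $ root = (\<Sum>v | v \<noteq> root \<and> u \<in> desc v. edge_drop q v)"
proof (induction "depth u" arbitrary: u)
  case 0
  then have u: "u = root" by (simp add: depth_0_iff)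
  have "(\<Sum>v | v \<noteq> root \<and> u \<in> desc v. edge_drop q v) = 0"
    by (rule sum.neutral) (auto simp: u root_in_desc_iff)
  then show ?case by (simp add: u)
next
  case (Suc k)
  then have u: "u \<noteq> root" using depth_root by auto
  have "parent u \<notin> desc u" using u by (intro not_desc_child) (simp add: children_def)
  moreover have "{v. v \<noteq> root \<and> u \<in> desc v} = insert u {v. v \<noteq> root \<and> parent u \<in> desc v}"
    using u desc_iff[of u] by auto
  moreover have "q $ parent u - q $ root = (\<Sum>v | v \<noteq> root \<and> parent u \<in> desc v. edge_drop q v)"
    using Suc depth_parent[OF u] by simp
  ultimately show ?case by (simp add: edge_drop_def)
qed

text \<open>
  Summation by parts in the tree: the increments of \<open>q\<close> along the edges pair with the total masses that
  \<open>q\<close> gives to the subtrees below them.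
\<close>

lemma unit_pairing:
  assumes "q \<in> Q"
  shows "1 = (\<Sum>v\<in>-{root}. edge_drop q v * desc_mass q v)"
proof -
  have "1 = (\<Sum>u\<in>UNIV. q $ u * q $ u)" using inner_self[OF assms] by (simp add: inner_vec_def)
  also have "\<dots> = (\<Sum>u\<in>UNIV. q $ u * (q $ u - q $ root))"
    using sum_zero[OF assms] by (simp add: right_diff_distrib sum_subtractf flip: sum_distrib_right)
  also have "\<dots> = (\<Sum>u\<in>UNIV. \<Sum>v\<in>-{root}. if u \<in> desc v then q $ u * edge_drop q v else 0)"
    by (subst telescope) (auto simp: sum_distrib_left sum.If_cases intro!: sum.cong)
  also have "\<dots> = (\<Sum>v\<in>-{root}. \<Sum>u\<in>UNIV. if u \<in> desc v then q $ u * edge_drop q v else 0)"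
    by (rule sum.swap)
  also have "\<dots> = (\<Sum>v\<in>-{root}. edge_drop q v * desc_mass q v)"
    by (simp add: sum.If_cases desc_mass_def sum_distrib_left mult.commute)
  finally show ?thesis .
qed

text \<open>
  The quadratic form of the pseudo-inverse of the Laplacian of the tree: the columns of its
  factor are the centred indicator vectors of the descendant sets.
\<close>

definition mass_norm :: "real^'n \<Rightarrow> real" where
  "mass_norm q = (\<Sum>v\<in>-{root}. (desc_mass q v)\<^sup>2)"

lemma mass_norm_bound:
  assumes "q \<in> Q"
  shows "1 \<le> (\<Sum>v\<in>-{root}. (edge_drop q v)\<^sup>2) * mass_norm q"
  using Cauchy_Schwarz_ineq_sum[of "edge_drop q" "desc_mass q" "-{root}"] unit_pairing[OF assms]
  by (simp add: mass_norm_def)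

text \<open>
  Cauchy-Schwarz in \<open>unit_pairing\<close>, with the increments bounded by the quadratic form.
\<close>

lemma inverse_ev_le:
  assumes q: "q \<in> Q"
  shows "1 / ev q \<le> mass_norm q"
proof -
  have "0 \<le> mass_norm q" by (auto simp: mass_norm_def intro: sum_nonneg)
  then have "1 \<le> ev q * mass_norm q"
    using mass_norm_bound[OF q] mult_right_mono[OF edge_drops_le] order_trans by blast
  then show ?thesis using ev_pos[OF q] by (simp add: field_simps)
qed

lemma inverse_ev_eq:
  assumes q: "q \<in> Q" and eq: "1 / ev q = mass_norm q"
  shows "ev q = (\<Sum>v\<in>-{root}. (edge_drop q v)\<^sup>2)"
  using mass_norm_bound[OF q] ev_pos[OF q] edge_drops_le[of q]
  by (simp add: field_simps flip: eq)

text \<open>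
  Parseval for the centred indicator vectors of the descendant sets, whose coefficients in the basis
  \<open>Q\<close> are the subtree masses.
\<close>

lemma cut_gram_masses: "cut_gram v w = (\<Sum>q\<in>Q. desc_mass q v * desc_mass q w)"
proof -
  define s :: "'n \<Rightarrow> real^'n" where
    "s v = (\<chi> u. (if u \<in> desc v then 1 else 0) - subsize v / real CARD('n))" for v
  have "1 \<bullet> s v = 0" for v
    by (simp add: s_def inner_vec_def sum_subtractf sum.If_cases)
  then have "s v \<bullet> s w = (\<Sum>q\<in>Q. (q \<bullet> s v) * (q \<bullet> s w))"
    by (intro orthonormal_parseval orth unit) (auto simp: span_Q)
  moreover have "q \<bullet> s v = desc_mass q v" if "q \<in> Q" for q v
    using sum_zero[OF that]
    by (simp add: s_def inner_vec_def right_diff_distrib sum_subtractf desc_mass_def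
        if_distrib[of "\<lambda>x. _ * x"] sum.If_cases flip: sum_distrib_right sum_divide_distrib cong: if_cong)
  moreover have "s v \<bullet> s w = cut_gram v w"
  proof -
    have "s v \<bullet> s w = (\<Sum>u\<in>UNIV. (if u \<in> desc v \<inter> desc w then 1 else 0)
        - subsize w / real CARD('n) * (if u \<in> desc v then 1 else 0)
        - subsize v / real CARD('n) * (if u \<in> desc w then 1 else 0)
        + subsize v / real CARD('n) * (subsize w / real CARD('n)))"
      unfolding s_def inner_vec_def by (intro sum.cong) (auto simp: algebra_simps)
    also have "\<dots> = cut_gram v w"
      unfolding sum.distrib sum_subtractf sum_distrib_left[symmetric]
      by (simp add: sum.If_cases cut_gram_def Int_def)
    finally show ?thesis .
  qed
  ultimately show ?thesis by simp
qed

lemma inverse_square_le_mass: "q \<in> Q \<Longrightarrow> 1 / (ev q)\<^sup>2 \<le> (mass_norm q)\<^sup>2"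
  using power_mono[OF inverse_ev_le, of q 2] ev_pos[of q] by (simp add: power_divide)

lemma mass_norm_sum_le: "(\<Sum>q\<in>Q. (mass_norm q)\<^sup>2) \<le> cut_gram_norm"
  unfolding mass_norm_def cut_gram_masses by (rule gram_sum_squares_le[OF finite_Q])

lemma inverse_square_sum_le_mass: "inverse_square_sum \<le> (\<Sum>q\<in>Q. (mass_norm q)\<^sup>2)"
  by (intro sum_mono inverse_square_le_mass)

theorem inverse_square_sum_le: "inverse_square_sum \<le> path_bound (real CARD('n))"
  using inverse_square_sum_le_mass mass_norm_sum_le cut_gram_norm_le by linarith

text \<open>
  Equality makes every estimate in the chain sharp. In particular no eigenvector changes along a
  non-tree arc, and \<open>separated\<close> then rules out such arcs.
\<close>

lemma spanning_tree_extremal: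
  assumes "inverse_square_sum = path_bound (real CARD('n))"
  shows "parcs G = tree_arcs" and "cut_gram_norm = path_bound (real CARD('n))"
proof -
  have sums: "(\<Sum>q\<in>Q. 1 / (ev q)\<^sup>2) = (\<Sum>q\<in>Q. (mass_norm q)\<^sup>2)"
    and "cut_gram_norm = path_bound (real CARD('n))"
    using assms inverse_square_sum_le_mass mass_norm_sum_le cut_gram_norm_le by linarith+
  then show "cut_gram_norm = path_bound (real CARD('n))" by blast
  have zero: "(\<Sum>(u, v)\<in>parcs G - tree_arcs. (q $ u - q $ v)\<^sup>2) = 0" if q: "q \<in> Q" for q
  proof -
    have "1 / (ev q)\<^sup>2 = (mass_norm q)\<^sup>2"
      by (rule sum_mono_inv[OF sums inverse_square_le_mass q finite_Q])
    then have "(1 / ev q)\<^sup>2 = (mass_norm q)\<^sup>2" by (simp add: power_divide)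
    moreover have "0 \<le> 1 / ev q" "0 \<le> mass_norm q"
      using ev_pos[OF q] by (auto simp: mass_norm_def intro: sum_nonneg)
    ultimately have "1 / ev q = mass_norm q" by (metis power2_eq_imp_eq)
    from inverse_ev_eq[OF q this] show ?thesis by (simp add: ev_split)
  qed
  have "(a, b) \<in> tree_arcs" if ab: "(a, b) \<in> parcs G" for a b
  proof (rule ccontr)
    assume not_tree: "(a, b) \<notin> tree_arcs"
    obtain q where q: "q \<in> Q" "q $ a \<noteq> q $ b" using separated no_loops'[OF ab] by blast
    have "0 < (\<Sum>(u, v)\<in>parcs G - tree_arcs. (q $ u - q $ v)\<^sup>2)"
      using ab not_tree q(2) by (intro sum_pos2[of _ "(a, b)"]) auto
    then show False using zero[OF q(1)] by simp
  qed
  then show "parcs G = tree_arcs" using tree_arcs_subset by auto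
qed

lemma path_graph_if_inj_depth:
  assumes inj: "inj depth" and tree: "parcs G = tree_arcs"
  shows "path_graph G"
proof -
  note bij = bij_depth[OF inj]
  define f where "f = inv depth"
  have f: "bij_betw f {..<CARD('n)} UNIV"
    unfolding f_def by (rule bij_betw_inv_into[OF bij])
  have depth_f: "depth (f i) = i" if "i < CARD('n)" for i
    using bij_betw_inv_into_right[OF bij, of i] that by (simp add: f_def)
  have arc: "(u, v) \<in> parcs G \<longleftrightarrow> depth v = Suc (depth u) \<or> depth u = Suc (depth v)" for u v
  proof
    assume "(u, v) \<in> parcs G"
    then show "depth v = Suc (depth u) \<or> depth u = Suc (depth v)"
      unfolding tree tree_arcs_def using depth_parent by auto
  next
    have "(u, v) \<in> parcs G" if uv: "depth u = Suc (depth v)" for u v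
    proof -
      have "u \<noteq> root" using uv depth_root by auto
      then have "depth (parent u) = depth v" using uv depth_parent by simp
      then have "parent u = v" using inj by (simp add: inj_eq)
      then show ?thesis using parent_arc[OF \<open>u \<noteq> root\<close>] by simp
    qed
    then show "depth v = Suc (depth u) \<or> depth u = Suc (depth v) \<Longrightarrow> (u, v) \<in> parcs G"
      using arc_sym by blast
  qed
  show ?thesis
    unfolding path_graph_def using f depth_f by (intro exI[of _ f]) (auto simp: arc)
qed

end

context diagonalised_network
begin

lemma spanning_tree_exists:
  fixes r :: 'n
  shows "\<exists>parent depth. network_spanning_tree G Q r parent depth"
proof -
  obtain parent depth where "rooted_tree r parent depth"
    and arcs: "\<And>v. v \<noteq> r \<Longrightarrow> (v, parent v) \<in> parcs G"
    using bfs_tree[of r] by blast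
  then interpret rooted_tree r parent depth by blast
  have "network_spanning_tree G Q r parent depth" using arcs by unfold_locales
  then show ?thesis by blast
qed

theorem inverse_square_sum_le_path_bound: "inverse_square_sum \<le> path_bound (real CARD('n))"
proof -
  obtain parent depth where "network_spanning_tree G Q undefined parent depth"
    using spanning_tree_exists by blast
  then interpret network_spanning_tree G Q undefined parent depth .
  show ?thesis by (rule inverse_square_sum_le)
qed

text \<open>
  In the equality case the graph coincides with each of its shortest-path trees, and only the root
  may branch. Rooting at a leaf removes this last exception, so each depth occurs once and the
  graph is a path.
\<close>

theorem inverse_square_sum_extremal:
  assumes eq: "inverse_square_sum = path_bound (real CARD('n))"
  shows "CARD('n) \<le> 4" and "path_graph G"
proof -
  fix r :: 'n
  obtain parent depth where T: "network_spanning_tree G Q r parent depth"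
    using spanning_tree_exists by blast
  interpret T: network_spanning_tree G Q r parent depth by (rule T)
  \<comment> \<open>A deepest vertex has no children, so it is a leaf of the graph.\<close>
  have "finite (range depth)" "range depth \<noteq> {}" by auto
  then obtain z where z: "depth z = Max (range depth)" using Max_in by (metis imageE)
  have deepest: "depth u \<le> depth z" for u unfolding z by (rule Max_ge) auto
  have leaf: "u = parent z" if "(z, u) \<in> parcs G" for u
  proof -
    have "(z, u) \<in> T.tree_arcs" using that T.spanning_tree_extremal(1)[OF eq] by simp
    then consider "u = parent z" | "u \<noteq> r" "z = parent u" by (auto simp: T.tree_arcs_def)
    then show ?thesis
    proof cases
      case 2
      then show ?thesis using T.depth_parent[of u] deepest[of u] by simp
    qed
  qed
  obtain parent' depth' where S: "network_spanning_tree G Q z parent' depth'"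
    using spanning_tree_exists by blast
  interpret S: network_spanning_tree G Q z parent' depth' by (rule S)
  note S_eq = S.spanning_tree_extremal[OF eq]
  have "c = d" if cd: "c \<in> S.children v" "d \<in> S.children v" for v c d
  proof (cases "v = z")
    case True
    then have "(z, c) \<in> parcs G" "(z, d) \<in> parcs G"
      using cd S.parent_arc[of c] S.parent_arc[of d] by (auto simp: S.children_def intro!: arc_sym)
    then show ?thesis using leaf by metis
  qed (use cd S.cut_gram_norm_eq_path_bound(1)[OF S_eq(2)] in blast)
  then have inj: "inj depth'" by (rule S.inj_depth)
  show "CARD('n) \<le> 4" by (rule S.path_card_le_4[OF inj S_eq(2)])
  show "path_graph G" by (rule S.path_graph_if_inj_depth[OF inj S_eq(1)])
qed

end

section \<open>The impulse response of a damped oscillator\<close>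

text \<open>
  The three cases are the overdamped, critically damped and underdamped oscillator after the
  factor \<open>exp (- d / 2 * s)\<close> is removed. Everything later uses only the differential equation.
\<close>

lemma oscillator_solution:
  fixes c :: real
  shows "\<exists>g g'. (\<forall>s. (g has_real_derivative g' s) (at s)) \<and>
    (\<forall>s. (g' has_real_derivative c * g s) (at s)) \<and> g 0 = 0 \<and> g' 0 = 1"
proof -
  consider "c > 0" | "c = 0" | "c < 0" by linarith
  then show ?thesis
  proof cases
    case 1
    then show ?thesis
      by (intro exI[of _ "\<lambda>s. sinh (sqrt c * s) / sqrt c"] exI[of _ "\<lambda>s. cosh (sqrt c * s)"])
        (auto intro!: derivative_eq_intros simp: field_simps)
  next
    case 2
    then show ?thesis
      by (intro exI[of _ "\<lambda>s. s"] exI[of _ "\<lambda>s. 1"]) (auto intro!: derivative_eq_intros)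
  next
    case 3
    define k where "k = sqrt (- c)"
    have k: "k > 0" "c = - (k * k)" using 3 by (simp_all add: k_def)
    then show ?thesis
      by (intro exI[of _ "\<lambda>s. sin (k * s) / k"] exI[of _ "\<lambda>s. cos (k * s)"])
        (auto intro!: derivative_eq_intros)
  qed
qed

text \<open>
  The response of \<open>h'' + d h' + l h = \<delta>\<close> to a unit impulse at time \<open>0\<close>; \<open>h'\<close> is a name for its derivative.
\<close>

locale impulse_response =
  fixes l d :: real and h h' :: "real \<Rightarrow> real"
  assumes l_pos: "l > 0" and d_pos: "d > 0"
    and h_deriv: "\<And>s. (h has_real_derivative h' s) (at s)"
    and h'_deriv: "\<And>s. (h' has_real_derivative - d * h' s - l * h s) (at s)"
    and h_0: "h 0 = 0" and h'_0: "h' 0 = 1"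

lemma impulse_response_exists:
  assumes "l > 0" "d > 0"
  shows "\<exists>h h'. impulse_response l d h h'"
proof -
  obtain g g' where g: "\<And>s. (g has_real_derivative g' s) (at s)"
    "\<And>s. (g' has_real_derivative (d\<^sup>2 / 4 - l) * g s) (at s)" "g 0 = 0" "g' 0 = 1"
    using oscillator_solution by metis
  define h where "h s = exp (- d / 2 * s) * g s" for s
  define h' where "h' s = exp (- d / 2 * s) * (g' s - d / 2 * g s)" for s
  have "(h has_real_derivative h' s) (at s)" for s
    unfolding h_def h'_def
    by (rule derivative_eq_intros g refl)+ (simp add: algebra_simps)
  moreover have "(h' has_real_derivative - d * h' s - l * h s) (at s)" for s
    unfolding h_def h'_def
    by (rule derivative_eq_intros g refl)+ (simp add: field_simps power2_eq_square)
  ultimately have "impulse_response l d h h'"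
    using assms g by unfold_locales (auto simp: h_def h'_def)
  then show ?thesis by blast
qed

context impulse_response
begin

lemma h'_cont: "continuous_on S h'"
  using h'_deriv by (auto intro!: DERIV_continuous_on intro: has_field_derivative_at_within)

text \<open>
  Each use picks \<open>p\<close>, \<open>q\<close>, \<open>r\<close> so that the derivative of the quadratic form becomes a prescribed
  negative form, that is, it solves a Lyapunov equation.
\<close>

lemma quadratic_form_deriv:
  "((\<lambda>s. p * (h s)\<^sup>2 + 2 * q * (h s * h' s) + r * (h' s)\<^sup>2) has_real_derivative
     - 2 * q * l * (h s)\<^sup>2 + 2 * (p - q * d - r * l) * (h s * h' s) + 2 * (q - r * d) * (h' s)\<^sup>2) (at s)"
  by (rule derivative_eq_intros h_deriv h'_deriv refl)+ (simp add: algebra_simps power2_eq_square)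

text \<open>
  A positive definite quadratic form \<open>V\<close> in \<open>(h, h')\<close> with derivative \<open>- (h\<^sup>2 + h'\<^sup>2) \<le> - V / C\<close> decays
  exponentially. This treats all damping regimes at once.
\<close>

lemma decay: "(h \<longlongrightarrow> 0) at_top" "(h' \<longlongrightarrow> 0) at_top"
proof -
  \<comment> \<open>These coefficients give the Lyapunov function \<open>V\<close> with \<open>V' = - (h\<^sup>2 + h'\<^sup>2)\<close>.\<close>
  define q where "q = 1 / (2 * l)"
  define r where "r = (1 + 1 / l) / (2 * d)"
  define p where "p = q * d + r * l"
  define V where "V s = p * (h s)\<^sup>2 + 2 * q * (h s * h' s) + r * (h' s)\<^sup>2" for s
  have pos: "q > 0" "r > 0" "p > 0" using l_pos d_pos by (auto simp: q_def r_def p_def add_pos_pos)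
  have coeff: "2 * q * l = 1" "2 * (r * d - q) = 1"
    using l_pos d_pos by (auto simp: q_def r_def field_simps)
  have V_deriv: "(V has_real_derivative - (h s)\<^sup>2 - (h' s)\<^sup>2) (at s)" for s
  proof -
    have "- 2 * q * l = - 1" "p - q * d - r * l = 0" "2 * (q - r * d) = - 1"
      using coeff by (simp_all add: p_def)
    then show ?thesis
      using quadratic_form_deriv[of p q r s] unfolding V_def by (simp only:) simp
  qed
  define C where "C = p + q + r"
  have C: "C > 0" using pos by (simp add: C_def)
  have V_upper: "V s \<le> C * ((h s)\<^sup>2 + (h' s)\<^sup>2)" for s
  proof -
    have "2 * (h s * h' s) \<le> (h s)\<^sup>2 + (h' s)\<^sup>2"
      using sum_squares_bound[of "h s" "h' s"] by simp
    then have "q * (2 * (h s * h' s)) \<le> q * ((h s)\<^sup>2 + (h' s)\<^sup>2)"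
      using pos by (intro mult_left_mono) auto
    moreover have "0 \<le> p * (h' s)\<^sup>2" "0 \<le> r * (h s)\<^sup>2" using pos by auto
    ultimately show ?thesis by (simp add: V_def C_def algebra_simps)
  qed
  have V_lower: "r * l * (h s)\<^sup>2 \<le> V s" "1 / (2 * d) * (h' s)\<^sup>2 \<le> V s" for s
  proof -
    have rd: "r = q / d + 1 / (2 * d)" using coeff(2) d_pos by (simp add: field_simps)
    \<comment> \<open>Completing the square, with \<open>p = q d + r l\<close>.\<close>
    have "V s = q / d * (d * h s + h' s)\<^sup>2 + r * l * (h s)\<^sup>2 + (r - q / d) * (h' s)\<^sup>2"
      using d_pos by (simp add: V_def p_def field_simps power2_eq_square)
    then have "V s = q / d * (d * h s + h' s)\<^sup>2 + r * l * (h s)\<^sup>2 + 1 / (2 * d) * (h' s)\<^sup>2"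
      using rd by simp
    moreover have "0 \<le> q / d * (d * h s + h' s)\<^sup>2" "0 \<le> r * l * (h s)\<^sup>2" "0 \<le> 1 / (2 * d) * (h' s)\<^sup>2"
      using pos d_pos l_pos by auto
    ultimately show "r * l * (h s)\<^sup>2 \<le> V s" "1 / (2 * d) * (h' s)\<^sup>2 \<le> V s" by linarith+
  qed
  have V_exp: "V t \<le> V 0 * exp (- t / C)" if "t \<ge> 0" for t
  proof -
    have "V t * exp (t / C) \<le> V 0 * exp (0 / C)"
    proof (rule DERIV_nonpos_imp_nonincreasing[OF that])
      fix s
      have exp_deriv: "((\<lambda>s. exp (s / C)) has_real_derivative exp (s / C) / C) (at s)"
        using DERIV_chain2[OF DERIV_exp DERIV_cdivide[OF DERIV_ident]] by simp
      have "((\<lambda>s. V s * exp (s / C)) has_real_derivative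
          (- (h s)\<^sup>2 - (h' s)\<^sup>2 + V s / C) * exp (s / C)) (at s)"
        by (rule DERIV_cong[OF DERIV_mult[OF V_deriv exp_deriv]]) (simp add: algebra_simps)
      moreover have "(- (h s)\<^sup>2 - (h' s)\<^sup>2 + V s / C) * exp (s / C) \<le> 0"
        using V_upper[of s] C by (intro mult_nonpos_nonneg) (auto simp: field_simps)
      ultimately show "\<exists>y. ((\<lambda>s. V s * exp (s / C)) has_real_derivative y) (at s) \<and> y \<le> 0" by blast
    qed
    then show ?thesis by (simp add: exp_minus field_simps)
  qed
  have "((\<lambda>t. V 0 * exp (- t / C)) \<longlongrightarrow> 0) at_top"
    using C by real_asymp
  then have "((\<lambda>t. K * (V 0 * exp (- t / C))) \<longlongrightarrow> 0) at_top" for K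
    by (rule tendsto_mult_right_zero)
  note lim = this
  have squeeze: "(u \<longlongrightarrow> 0) at_top" if K: "K > 0" "\<And>s. K * (u s)\<^sup>2 \<le> V s" for u K
  proof -
    have "((\<lambda>t. (u t)\<^sup>2) \<longlongrightarrow> 0) at_top"
    proof (rule tendsto_sandwich[OF _ _ tendsto_const lim[of "1 / K"]])
      show "\<forall>\<^sub>F t in at_top. (u t)\<^sup>2 \<le> 1 / K * (V 0 * exp (- t / C))"
        using eventually_ge_at_top[of 0]
      proof eventually_elim
        case (elim t)
        then show ?case using K(2)[of t] V_exp[of t] K(1) by (simp add: field_simps)
      qed
    qed auto
    then have "((\<lambda>t. sqrt ((u t)\<^sup>2)) \<longlongrightarrow> sqrt 0) at_top" by (rule tendsto_real_sqrt)
    then show ?thesis by (simp add: tendsto_rabs_zero_iff)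
  qed
  show "(h \<longlongrightarrow> 0) at_top" using pos l_pos V_lower(1) by (intro squeeze[of "r * l"]) auto
  show "(h' \<longlongrightarrow> 0) at_top" using d_pos V_lower(2) by (intro squeeze[of "1 / (2 * d)"]) auto
qed

text \<open>
  With the quadratic form \<open>Q\<close> satisfying \<open>Q' = - h\<^sup>2\<close>, the energy up to time \<open>t\<close> is \<open>Q 0 - Q t\<close>, and \<open>Q t\<close>
  vanishes in the limit by \<open>decay\<close>.
\<close>

lemma energy: "((\<lambda>t. integral {0..t} (\<lambda>s. (h (t - s))\<^sup>2)) \<longlongrightarrow> 1 / (2 * l * d)) at_top"
proof -
  define q where "q = 1 / (2 * l)"
  define r where "r = 1 / (2 * l * d)"
  define Q where "Q s = (q * d + r * l) * (h s)\<^sup>2 + 2 * q * (h s * h' s) + r * (h' s)\<^sup>2" for s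
  have Q_deriv: "(Q has_real_derivative - (h s)\<^sup>2) (at s)" for s
  proof -
    have "2 * q * l = 1" "q - r * d = 0" using l_pos d_pos by (auto simp: q_def r_def)
    then show ?thesis
      using quadratic_form_deriv[of "q * d + r * l" q r s] unfolding Q_def by simp
  qed
  have "integral {0..t} (\<lambda>s. (h (t - s))\<^sup>2) = r - Q t" if "t \<ge> 0" for t
  proof -
    have "((\<lambda>s. Q (t - s)) has_real_derivative (h (t - s))\<^sup>2) (at s within {0..t})" for s
      using DERIV_chain2[OF Q_deriv DERIV_diff[OF DERIV_const DERIV_ident], of t s "{0..t}"] by simp
    then have "((\<lambda>s. (h (t - s))\<^sup>2) has_integral (Q (t - t) - Q (t - 0))) {0..t}"
      using that by (intro fundamental_theorem_of_calculus)
        (auto simp: has_real_derivative_iff_has_vector_derivative)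
    then show ?thesis by (simp add: integral_unique Q_def h_0 h'_0)
  qed
  then have "\<forall>\<^sub>F t in at_top. r - Q t = integral {0..t} (\<lambda>s. (h (t - s))\<^sup>2)"
    by (intro eventually_mono[OF eventually_ge_at_top[of 0]]) simp
  moreover have "((\<lambda>t. r - Q t) \<longlongrightarrow> r - ((q * d + r * l) * 0\<^sup>2 + 2 * q * (0 * 0) + r * 0\<^sup>2)) at_top"
    unfolding Q_def by (intro tendsto_intros decay)
  ultimately show ?thesis
    by (auto simp: r_def intro: Lim_transform_eventually)
qed

text \<open>
  The noise enters through its primitive \<open>w\<close>, which need not be differentiable. Subtracting it
  leaves a differentiable velocity \<open>u = b - w\<close>; pairing \<open>(a, u)\<close> with the solution of the adjoint
  equation running backwards from time \<open>T\<close> leaves only the term with \<open>w\<close>.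
\<close>

lemma variation_of_constants:
  fixes a b w :: "real \<Rightarrow> real"
  assumes T: "0 \<le> T"
    and cont: "continuous_on {0..T} a" "continuous_on {0..T} b" "continuous_on {0..T} w"
    and a: "\<And>t. t \<in> {0..T} \<Longrightarrow> a t = a 0 + integral {0..t} b"
    and b: "\<And>t. t \<in> {0..T} \<Longrightarrow> b t = b 0 - integral {0..t} (\<lambda>s. l * a s + d * b s) + w t"
  shows "a T = h T * b 0 + (h' T + d * h T) * a 0 + integral {0..T} (\<lambda>s. h' (T - s) * w s)"
proof -
  define u where "u t = b 0 - integral {0..t} (\<lambda>s. l * a s + d * b s)" for t
  have bu: "b t = u t + w t" if "t \<in> {0..T}" for t using b[OF that] by (simp add: u_def)
  have a_deriv: "(a has_real_derivative b s) (at s within {0..T})" if s: "s \<in> {0..T}" for s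
  proof -
    have "((\<lambda>t. a 0 + integral {0..t} b) has_real_derivative b s) (at s within {0..T})"
      using DERIV_add[OF DERIV_const integral_has_real_derivative[OF cont(2) s]] by simp
    then show ?thesis
      by (rule has_field_derivative_transform_within[of _ _ _ _ 1]) (use a[symmetric] s in auto)
  qed
  have u_deriv: "(u has_real_derivative - (l * a s + d * b s)) (at s within {0..T})"
    if s: "s \<in> {0..T}" for s
  proof -
    have "continuous_on {0..T} (\<lambda>s. l * a s + d * b s)" by (intro continuous_intros cont)
    from DERIV_diff[OF DERIV_const integral_has_real_derivative[OF this s]] show ?thesis
      unfolding u_def by simp
  qed
  define \<Phi> where "\<Phi> s = h (T - s) * u s + (h' (T - s) + d * h (T - s)) * a s" for s
  have "(\<Phi> has_real_derivative h' (T - s) * w s) (at s within {0..T})" if s: "s \<in> {0..T}" for s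
  proof -
    have shift: "((\<lambda>s. T - s) has_real_derivative - 1) (at s within {0..T})"
      using DERIV_diff[OF DERIV_const DERIV_ident] by simp
    have hT: "((\<lambda>s. h (T - s)) has_real_derivative - h' (T - s)) (at s within {0..T})"
      using DERIV_chain2[OF h_deriv shift] by simp
    have h'T: "((\<lambda>s. h' (T - s)) has_real_derivative d * h' (T - s) + l * h (T - s)) (at s within {0..T})"
      using DERIV_chain2[OF h'_deriv shift] by (simp add: add.commute)
    show ?thesis
      unfolding \<Phi>_def
      by (rule DERIV_cong[OF DERIV_add[OF DERIV_mult[OF hT u_deriv[OF s]]
            DERIV_mult[OF DERIV_add[OF h'T DERIV_cmult[OF hT]] a_deriv[OF s]]]])
        (use bu[OF s] in \<open>simp add: algebra_simps\<close>)
  qed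
  then have "((\<lambda>s. h' (T - s) * w s) has_integral (\<Phi> T - \<Phi> 0)) {0..T}"
    using T by (intro fundamental_theorem_of_calculus)
      (auto simp: has_real_derivative_iff_has_vector_derivative)
  moreover have "\<Phi> T = a T" by (simp add: \<Phi>_def h_0 h'_0)
  moreover have "\<Phi> 0 = h T * b 0 + (h' T + d * h T) * a 0" by (simp add: \<Phi>_def u_def)
  ultimately show ?thesis by (simp add: integral_unique)
qed

end

section \<open>Integrals against integrated white noise\<close>

text \<open>
  Integration by parts, twice: \<open>min s r\<close> is the covariance of integrated white noise, and with \<open>G\<close> the
  primitive of \<open>- g\<close> vanishing at \<open>T\<close> the double integral is the Ito isometry for \<open>\<integral> G dw\<close>.
\<close>

lemma min_kernel_integral:
  fixes g G :: "real \<Rightarrow> real"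
  assumes T: "0 \<le> T" and g: "continuous_on UNIV g"
    and G: "\<And>s. (G has_real_derivative - g s) (at s)" and GT: "G T = 0"
  shows "integral {0..T} (\<lambda>s. integral {0..T} (\<lambda>r. g s * g r * min s r)) = integral {0..T} (\<lambda>s. (G s)\<^sup>2)"
proof -
  have cG: "continuous_on S G" for S
    using G by (auto intro!: DERIV_continuous_on intro: has_field_derivative_at_within)
  define \<Phi> where "\<Phi> s = integral {0..s} G" for s
  have \<Phi>: "(\<Phi> has_real_derivative G s) (at s within {0..t})" if "s \<in> {0..t}" for s t
    unfolding \<Phi>_def using integral_has_real_derivative[OF cG that] .
  have G': "(G has_real_derivative - g s) (at s within S)" for s S
    using G by (rule has_field_derivative_at_within)
  have inner: "integral {0..T} (\<lambda>r. g s * g r * min s r) = g s * \<Phi> s" if s: "s \<in> {0..T}" for s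
  proof -
    have "((\<lambda>r. g r * r) has_integral (\<Phi> s - s * G s) - (\<Phi> 0 - 0 * G 0)) {0..s}"
    proof (rule fundamental_theorem_of_calculus)
      fix r assume r: "r \<in> {0..s}"
      have "((\<lambda>r. \<Phi> r - r * G r) has_real_derivative g r * r) (at r within {0..s})"
        by (rule DERIV_cong[OF DERIV_diff[OF \<Phi>[OF r] DERIV_mult[OF DERIV_ident G']]])
          (simp add: algebra_simps)
      then show "((\<lambda>r. \<Phi> r - r * G r) has_vector_derivative g r * r) (at r within {0..s})"
        by (simp add: has_real_derivative_iff_has_vector_derivative)
    qed (use s in auto)
    then have 1: "((\<lambda>r. g r * min s r) has_integral \<Phi> s - s * G s) {0..s}"
      by (subst has_integral_cong[where g = "\<lambda>r. g r * r"]) (auto simp: \<Phi>_def)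
    have "((\<lambda>r. g r * s) has_integral (- s * G T) - (- s * G s)) {s..T}"
    proof (rule fundamental_theorem_of_calculus)
      fix r
      have "((\<lambda>r. - s * G r) has_real_derivative g r * s) (at r within {s..T})"
        by (rule DERIV_cong[OF DERIV_cmult[OF G']]) (simp add: algebra_simps)
      then show "((\<lambda>r. - s * G r) has_vector_derivative g r * s) (at r within {s..T})"
        by (simp add: has_real_derivative_iff_has_vector_derivative)
    qed (use s in auto)
    then have 2: "((\<lambda>r. g r * min s r) has_integral s * G s) {s..T}"
      by (subst has_integral_cong[where g = "\<lambda>r. g r * s"]) (auto simp: GT)
    have "((\<lambda>r. g r * min s r) has_integral \<Phi> s) {0..T}"
      using has_integral_combine[OF _ _ 1 2] s by simp
    from integral_unique[OF has_integral_mult_right[OF this, of "g s"]] show ?thesis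
      by (simp only: mult.assoc)
  qed
  have "((\<lambda>s. g s * \<Phi> s - (G s)\<^sup>2) has_integral (- G T * \<Phi> T) - (- G 0 * \<Phi> 0)) {0..T}"
  proof (rule fundamental_theorem_of_calculus)
    fix s assume s: "s \<in> {0..T}"
    have "((\<lambda>s. - G s * \<Phi> s) has_real_derivative g s * \<Phi> s - (G s)\<^sup>2) (at s within {0..T})"
      by (rule DERIV_cong[OF DERIV_mult[OF DERIV_minus[OF G'] \<Phi>[OF s]]])
        (simp add: power2_eq_square)
    then show "((\<lambda>s. - G s * \<Phi> s) has_vector_derivative g s * \<Phi> s - (G s)\<^sup>2) (at s within {0..T})"
      by (simp add: has_real_derivative_iff_has_vector_derivative)
  qed (use T in auto)
  then have zero: "((\<lambda>s. g s * \<Phi> s - (G s)\<^sup>2) has_integral 0) {0..T}"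
    by (simp add: GT \<Phi>_def)
  have "(\<lambda>s. (G s)\<^sup>2) integrable_on {0..T}"
    by (intro integrable_continuous_real continuous_intros cG)
  from has_integral_add[OF zero integrable_integral[OF this]]
  have "integral {0..T} (\<lambda>s. g s * \<Phi> s) = integral {0..T} (\<lambda>s. (G s)\<^sup>2)"
    by (simp add: integral_unique)
  moreover have "integral {0..T} (\<lambda>s. integral {0..T} (\<lambda>r. g s * g r * min s r)) = integral {0..T} (\<lambda>s. g s * \<Phi> s)"
    by (intro integral_cong inner)
  ultimately show ?thesis by simp
qed

abbreviation interval_measure :: "real \<Rightarrow> real measure" where
  "interval_measure T \<equiv> restrict_space lborel {0..T}"

lemma interval_measure_finite: "finite_measure (interval_measure T)"
  by (rule finite_measureI) (simp add: emeasure_restrict_space emeasure_lborel_Icc_eq space_restrict_space)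

lemma interval_measure_integral:
  fixes f :: "real \<Rightarrow> real"
  assumes "continuous_on {0..T} f"
  shows "integrable (interval_measure T) f" "integral\<^sup>L (interval_measure T) f = integral {0..T} f"
proof -
  have f: "set_integrable lborel {0..T} f" by (rule borel_integrable_atLeastAtMost'[OF assms])
  then show "integrable (interval_measure T) f"
    by (simp add: integrable_restrict_space set_integrable_def)
  show "integral\<^sup>L (interval_measure T) f = integral {0..T} f"
    using set_borel_integral_eq_integral(2)[OF f]
    by (simp add: integral_restrict_space set_lebesgue_integral_def)
qed

lemma interval_measure_pair_finite: "finite_measure (interval_measure T \<Otimes>\<^sub>M interval_measure T)"
  by (intro finite_measure_pair_measure interval_measure_finite)

lemma interval_measure_pair_square:
  fixes u :: "real \<Rightarrow> real"
  assumes u: "integrable (interval_measure T) u"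
  shows "(\<integral>p. u (fst p) * u (snd p) \<partial>(interval_measure T \<Otimes>\<^sub>M interval_measure T)) = (integral\<^sup>L (interval_measure T) u)\<^sup>2"
proof -
  define I where "I = interval_measure T"
  interpret I: finite_measure I unfolding I_def by (rule interval_measure_finite)
  interpret II: pair_sigma_finite I I by unfold_locales
  have u[measurable, simp]: "integrable I u" using u by (simp add: I_def)
  then have [measurable]: "u \<in> borel_measurable I" by simp
  have "integrable (I \<Otimes>\<^sub>M I) (\<lambda>p. u (fst p) * u (snd p))"
    by (rule II.Fubini_integrable) (simp_all add: abs_mult)
  from II.integral_fst'[OF this] show ?thesis by (simp add: power2_eq_square I_def)
qed

lemma interval_measure_pair_integral:
  fixes K :: "real \<times> real \<Rightarrow> real"
  assumes K: "continuous_on UNIV K"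
  shows "integral\<^sup>L (interval_measure T \<Otimes>\<^sub>M interval_measure T) K
      = integral {0..T} (\<lambda>s. integral {0..T} (\<lambda>r. K (s, r)))"
proof -
  define I where "I = interval_measure T"
  interpret I: finite_measure I unfolding I_def by (rule interval_measure_finite)
  interpret II: pair_sigma_finite I I by unfold_locales
  interpret P: finite_measure "I \<Otimes>\<^sub>M I" unfolding I_def by (rule interval_measure_pair_finite)
  have [measurable]: "(\<lambda>s. s) \<in> measurable I borel" unfolding I_def by (rule measurable_restrict_space1) simp
  have "K \<in> borel_measurable (borel \<Otimes>\<^sub>M borel)"
    using borel_measurable_continuous_onI[OF K] by (simp add: borel_prod)
  then have "(\<lambda>p. K (fst p, snd p)) \<in> borel_measurable (I \<Otimes>\<^sub>M I)"
    by (rule measurable_compose[rotated]) measurable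
  then have K_meas: "K \<in> borel_measurable (I \<Otimes>\<^sub>M I)" by simp
  have "bounded (K ` ({0..T} \<times> {0..T}))"
    by (intro compact_imp_bounded compact_continuous_image compact_Times continuous_on_subset[OF K]) auto
  then obtain B where B: "\<And>p. p \<in> {0..T} \<times> {0..T} \<Longrightarrow> \<bar>K p\<bar> \<le> B" by (auto simp: bounded_iff)
  have "integrable (I \<Otimes>\<^sub>M I) K"
    by (rule P.integrable_const_bound[of _ B])
      (use B K_meas in \<open>auto simp: I_def space_pair_measure intro!: AE_I2\<close>)
  from II.integral_fst'[OF this, symmetric]
  have "integral\<^sup>L (I \<Otimes>\<^sub>M I) K = (\<integral>s. integral\<^sup>L I (\<lambda>r. K (s, r)) \<partial>I)" .
  also have "\<dots> = (\<integral>s. integral {0..T} (\<lambda>r. K (s, r)) \<partial>I)"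
    unfolding I_def by (intro Bochner_Integration.integral_cong refl interval_measure_integral(2)
      continuous_on_compose2[OF K]) (auto intro!: continuous_intros)
  also have "\<dots> = integral {0..T} (\<lambda>s. integral {0..T} (\<lambda>r. K (s, r)))"
    unfolding I_def
  proof (rule interval_measure_integral(2))
    show "continuous_on {0..T} (\<lambda>s. integral {0..T} (\<lambda>r. K (s, r)))"
      unfolding interval_cbox
      by (rule integral_continuous_on_param) (auto simp: case_prod_beta intro: continuous_on_subset[OF K])
  qed
  finally show ?thesis by (simp add: I_def)
qed

lemma integrable_mult_square_integrable:
  fixes X Y :: "'a \<Rightarrow> real"
  assumes [measurable]: "X \<in> borel_measurable M" "Y \<in> borel_measurable M"
    and sq: "integrable M (\<lambda>\<omega>. (X \<omega>)\<^sup>2)" "integrable M (\<lambda>\<omega>. (Y \<omega>)\<^sup>2)"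
  shows "integrable M (\<lambda>\<omega>. X \<omega> * Y \<omega>)"
    and "(\<integral>\<omega>. \<bar>X \<omega> * Y \<omega>\<bar> \<partial>M) \<le> ((\<integral>\<omega>. (X \<omega>)\<^sup>2 \<partial>M) + (\<integral>\<omega>. (Y \<omega>)\<^sup>2 \<partial>M)) / 2"
proof -
  have young: "\<bar>x * y\<bar> \<le> (x\<^sup>2 + y\<^sup>2) / 2" for x y :: real
    using sum_squares_bound[of "\<bar>x\<bar>" "\<bar>y\<bar>"] by (simp add: abs_mult)
  have sum: "integrable M (\<lambda>\<omega>. ((X \<omega>)\<^sup>2 + (Y \<omega>)\<^sup>2) / 2)" using sq by simp
  show XY: "integrable M (\<lambda>\<omega>. X \<omega> * Y \<omega>)"
    by (rule Bochner_Integration.integrable_bound[OF sum]) (use young in \<open>auto simp: abs_of_nonneg\<close>)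
  have "(\<integral>\<omega>. \<bar>X \<omega> * Y \<omega>\<bar> \<partial>M) \<le> (\<integral>\<omega>. ((X \<omega>)\<^sup>2 + (Y \<omega>)\<^sup>2) / 2 \<partial>M)"
    using XY sum young by (intro integral_mono) auto
  then show "(\<integral>\<omega>. \<bar>X \<omega> * Y \<omega>\<bar> \<partial>M) \<le> ((\<integral>\<omega>. (X \<omega>)\<^sup>2 \<partial>M) + (\<integral>\<omega>. (Y \<omega>)\<^sup>2 \<partial>M)) / 2"
    using sq by simp
qed

text \<open>
  Fubini needs joint measurability in time and outcome. The values on ever finer grids
  depend on time through countably many measurable pieces, so they are jointly measurable; for continuous paths they converge
  to the process.
\<close>

lemma jointly_measurable_version:
  fixes w :: "real \<Rightarrow> 'a \<Rightarrow> real"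
  assumes meas: "\<And>t. 0 \<le> t \<Longrightarrow> w t \<in> borel_measurable M"
    and cont: "AE \<omega> in M. continuous_on {0..} (\<lambda>t. w t \<omega>)"
  shows "\<exists>F. case_prod F \<in> borel_measurable (borel \<Otimes>\<^sub>M M) \<and> (AE \<omega> in M. \<forall>s\<ge>0. F s \<omega> = w s \<omega>)"
proof -
  define grid where "grid n s = real (nat \<lfloor>real (Suc n) * s\<rfloor>) / real (Suc n)" for n s
  define F where "F s \<omega> = lim (\<lambda>n. w (grid n s) \<omega>)" for s \<omega>
  have "(\<lambda>x. w (grid n (fst x)) (snd x)) \<in> borel_measurable (borel \<Otimes>\<^sub>M M)" for n
  proof -
    have [measurable]: "w (real i / real (Suc n)) \<in> borel_measurable M" for i by (rule meas) simp
    have "(\<lambda>x. (\<lambda>i x. w (real i / real (Suc n)) (snd x)) (nat \<lfloor>real (Suc n) * fst x\<rfloor>) x)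
        \<in> borel_measurable (borel \<Otimes>\<^sub>M M)"
      by (rule measurable_compose_countable) measurable
    then show ?thesis by (simp add: grid_def)
  qed
  then have "case_prod F \<in> borel_measurable (borel \<Otimes>\<^sub>M M)"
    unfolding F_def case_prod_beta by (rule borel_measurable_lim_metric)
  moreover have "AE \<omega> in M. \<forall>s\<ge>0. F s \<omega> = w s \<omega>"
    using cont
  proof eventually_elim
    case (elim \<omega>)
    show ?case
    proof (intro allI impI)
      fix s :: real assume s: "0 \<le> s"
      have "(\<lambda>n. grid n s) \<longlonglongrightarrow> s"
      proof (rule tendsto_sandwich[of "\<lambda>n. s - 1 / real (Suc n)" _ _ "\<lambda>n. s"])
        have "real (nat \<lfloor>real (Suc n) * s\<rfloor>) \<le> real (Suc n) * s" for n
          using s by (simp add: of_nat_nat)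
        then show "\<forall>\<^sub>F n in sequentially. grid n s \<le> s"
          by (intro always_eventually allI) (simp add: grid_def divide_le_eq mult.commute)
        have "real (Suc n) * s - 1 \<le> real (nat \<lfloor>real (Suc n) * s\<rfloor>)" for n
          by linarith
        then have "(real (Suc n) * s - 1) / real (Suc n) \<le> grid n s" for n
          unfolding grid_def by (rule divide_right_mono) simp
        then show "\<forall>\<^sub>F n in sequentially. s - 1 / real (Suc n) \<le> grid n s"
          by (intro always_eventually allI) (simp add: diff_divide_distrib del: of_nat_Suc)
        show "(\<lambda>n. s - 1 / real (Suc n)) \<longlonglongrightarrow> s"
          by real_asymp
      qed simp
      then have "(\<lambda>n. w (grid n s) \<omega>) \<longlonglongrightarrow> w s \<omega>"
        using continuous_on_tendsto_compose[OF elim, of "\<lambda>n. grid n s" s sequentially] s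
        by (auto simp: grid_def)
      then show "F s \<omega> = w s \<omega>" unfolding F_def by (rule limI)
    qed
  qed
  ultimately show ?thesis by blast
qed

text \<open>
  The square of the path integral is a double integral over \<open>[0, T]\<^sup>2\<close>, and Fubini moves the
  expectation inside, where only the covariance of \<open>w\<close> remains. The variable \<open>X\<close> is given separately because the path integral
  is only known to be measurable up to a null set.
\<close>

lemma (in prob_space) second_moment_noise_integral:
  fixes w :: "real \<Rightarrow> 'a \<Rightarrow> real"
  assumes meas: "\<And>t. 0 \<le> t \<Longrightarrow> w t \<in> borel_measurable M"
    and sq: "\<And>t. 0 \<le> t \<Longrightarrow> integrable M (\<lambda>\<omega>. (w t \<omega>)\<^sup>2)"
    and cont: "AE \<omega> in M. continuous_on {0..} (\<lambda>t. w t \<omega>)"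
    and cov: "\<And>s t. 0 \<le> s \<Longrightarrow> 0 \<le> t \<Longrightarrow> expectation (\<lambda>\<omega>. w s \<omega> * w t \<omega>) = min s t"
    and T: "0 \<le> T" and g: "continuous_on UNIV g"
    and X[measurable]: "X \<in> borel_measurable M"
    and X_eq: "AE \<omega> in M. X \<omega> = integral {0..T} (\<lambda>s. g s * w s \<omega>)"
  shows "integrable M (\<lambda>\<omega>. (X \<omega>)\<^sup>2)"
    and "expectation (\<lambda>\<omega>. (X \<omega>)\<^sup>2)
      = integral {0..T} (\<lambda>s. integral {0..T} (\<lambda>r. g s * g r * min s r))"
proof -
  obtain F where F[measurable]: "case_prod F \<in> borel_measurable (borel \<Otimes>\<^sub>M M)"
    and F_eq: "AE \<omega> in M. \<forall>s\<ge>0. F s \<omega> = w s \<omega>"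
    using jointly_measurable_version[OF meas cont] by blast
  have [measurable]: "g \<in> borel_measurable borel" using g by (rule borel_measurable_continuous_onI)
  define I where "I = interval_measure T"
  interpret I: finite_measure I unfolding I_def by (rule interval_measure_finite)
  define P where "P = I \<Otimes>\<^sub>M I"
  interpret P: finite_measure P unfolding P_def by (rule finite_measure_pair_measure) unfold_locales
  interpret PM: pair_sigma_finite P M by unfold_locales
  interpret II: pair_sigma_finite I I by unfold_locales
  have space_P: "p \<in> space P \<longleftrightarrow> 0 \<le> fst p \<and> fst p \<le> T \<and> 0 \<le> snd p \<and> snd p \<le> T" for p
    by (cases p) (auto simp: P_def I_def space_pair_measure)
  have [measurable]: "(\<lambda>s. s) \<in> measurable I borel" unfolding I_def by (rule measurable_restrict_space1) simp
  have [measurable]: "fst \<in> measurable P borel" "snd \<in> measurable P borel"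
    unfolding P_def by measurable
  define f where "f p \<omega> = g (fst p) * g (snd p) * (F (fst p) \<omega> * F (snd p) \<omega>)" for p \<omega>
  have f_meas[measurable]: "case_prod f \<in> borel_measurable (P \<Otimes>\<^sub>M M)"
    unfolding f_def by measurable
  have ww: "integrable M (\<lambda>\<omega>. w s \<omega> * w r \<omega>)" if "0 \<le> s" "0 \<le> r" for s r
    using meas[OF that(1)] meas[OF that(2)] sq[OF that(1)] sq[OF that(2)]
    by (rule integrable_mult_square_integrable(1))
  have FF_eq: "AE \<omega> in M. f p \<omega> = g (fst p) * g (snd p) * (w (fst p) \<omega> * w (snd p) \<omega>)" if "p \<in> space P" for p
    using F_eq by eventually_elim (use that in \<open>simp add: f_def space_P\<close>)
  have [measurable]: "(\<lambda>\<omega>. f p \<omega>) \<in> borel_measurable M" if "p \<in> space P" for p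
    using f_meas that by measurable
  have f_int: "integrable M (f p)" if "p \<in> space P" for p
  proof -
    have "integrable M (\<lambda>\<omega>. g (fst p) * g (snd p) * (w (fst p) \<omega> * w (snd p) \<omega>))"
      using that by (intro integrable_mult_right ww) (auto simp: space_P)
    then show ?thesis using FF_eq[OF that] that
      by (subst integrable_cong_AE) (auto simp: space_P intro!: borel_measurable_times meas)
  qed
  have f_exp: "expectation (f p) = g (fst p) * g (snd p) * min (fst p) (snd p)" if "p \<in> space P" for p
  proof -
    have "expectation (f p) = expectation (\<lambda>\<omega>. g (fst p) * g (snd p) * (w (fst p) \<omega> * w (snd p) \<omega>))"
      using FF_eq[OF that] that
      by (intro integral_cong_AE) (auto simp: space_P intro!: borel_measurable_times meas)
    then show ?thesis using that by (simp add: cov space_P)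
  qed
  have "bounded (g ` {0..T})"
    by (intro compact_imp_bounded compact_continuous_image continuous_on_subset[OF g]) auto
  then obtain B where "\<forall>s\<in>{0..T}. \<bar>g s\<bar> \<le> B" by (auto simp: bounded_iff)
  then have B: "\<bar>g s\<bar> \<le> B" if "s \<in> {0..T}" for s using that by blast
  have f_abs: "(\<integral>\<omega>. \<bar>f p \<omega>\<bar> \<partial>M) \<le> B * B * T" if p: "p \<in> space P" for p
  proof -
    have w2: "expectation (\<lambda>\<omega>. (w s \<omega>)\<^sup>2) = s" if "0 \<le> s" for s
      using cov[OF that that] by (simp add: power2_eq_square)
    have "(\<integral>\<omega>. \<bar>f p \<omega>\<bar> \<partial>M)
        = (\<integral>\<omega>. \<bar>g (fst p)\<bar> * \<bar>g (snd p)\<bar> * \<bar>w (fst p) \<omega> * w (snd p) \<omega>\<bar> \<partial>M)"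
      using p by (intro integral_cong_AE eventually_mono[OF FF_eq[OF p]])
        (auto simp: space_P abs_mult intro!: borel_measurable_times borel_measurable_abs meas)
    also have "\<dots> = \<bar>g (fst p)\<bar> * \<bar>g (snd p)\<bar> * (\<integral>\<omega>. \<bar>w (fst p) \<omega> * w (snd p) \<omega>\<bar> \<partial>M)"
      by simp
    also have "\<dots> \<le> B * B * T"
    proof (intro mult_mono B)
      have "(\<integral>\<omega>. \<bar>w (fst p) \<omega> * w (snd p) \<omega>\<bar> \<partial>M) \<le> (fst p + snd p) / 2"
        using integrable_mult_square_integrable(2)[OF meas meas sq sq, of "fst p" "snd p"] p
        by (simp add: space_P w2)
      also have "\<dots> \<le> T" using p by (simp add: space_P)
      finally show "(\<integral>\<omega>. \<bar>w (fst p) \<omega> * w (snd p) \<omega>\<bar> \<partial>M) \<le> T" .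
    qed (use p B[of 0] T in \<open>auto simp: space_P intro: order_trans[OF abs_ge_zero]\<close>)
    finally show ?thesis .
  qed
  have f_integrable: "integrable (P \<Otimes>\<^sub>M M) (case_prod f)"
  proof (rule PM.Fubini_integrable[OF f_meas])
    show "integrable P (\<lambda>p. \<integral>\<omega>. norm (case (p, \<omega>) of (p, \<omega>) \<Rightarrow> f p \<omega>) \<partial>M)"
    proof (rule P.integrable_const_bound[of _ "B * B * T"])
      show "AE p in P. norm (\<integral>\<omega>. norm (case (p, \<omega>) of (p, \<omega>) \<Rightarrow> f p \<omega>) \<partial>M) \<le> B * B * T"
        using f_abs by (intro AE_I2) simp
    qed measurable
    show "AE p in P. integrable M (\<lambda>\<omega>. case (p, \<omega>) of (p, \<omega>) \<Rightarrow> f p \<omega>)"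
      using f_int by (intro AE_I2) simp
  qed
  have X2: "AE \<omega> in M. (\<integral>p. f p \<omega> \<partial>P) = (X \<omega>)\<^sup>2"
    using X_eq F_eq cont
  proof eventually_elim
    case (elim \<omega>)
    have "continuous_on {0..T} (\<lambda>s. g s * w s \<omega>)"
      by (intro continuous_intros continuous_on_subset[OF g] continuous_on_subset[OF elim(3)]) auto
    note u = interval_measure_integral[OF this, folded I_def]
    have "(\<integral>p. f p \<omega> \<partial>P) = (\<integral>p. (g (fst p) * w (fst p) \<omega>) * (g (snd p) * w (snd p) \<omega>) \<partial>P)"
      using elim(2) by (intro Bochner_Integration.integral_cong) (auto simp: f_def space_P)
    also have "\<dots> = (X \<omega>)\<^sup>2"
      using interval_measure_pair_square[OF u(1)[unfolded I_def]] u(2) elim(1)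
      by (simp add: P_def I_def)
    finally show ?case .
  qed
  have outer: "integrable M (\<lambda>\<omega>. \<integral>p. f p \<omega> \<partial>P)"
    by (rule PM.integrable_snd[OF f_integrable])
  have [measurable]: "(\<lambda>\<omega>. \<integral>p. f p \<omega> \<partial>P) \<in> borel_measurable M"
    using outer by simp
  show "integrable M (\<lambda>\<omega>. (X \<omega>)\<^sup>2)"
    using outer X2 by (subst integrable_cong_AE[where g = "\<lambda>\<omega>. \<integral>p. f p \<omega> \<partial>P"]) auto
  have "expectation (\<lambda>\<omega>. (X \<omega>)\<^sup>2) = expectation (\<lambda>\<omega>. \<integral>p. f p \<omega> \<partial>P)"
    using X2 by (intro integral_cong_AE) auto
  also have "\<dots> = (\<integral>p. expectation (f p) \<partial>P)"
    by (rule PM.Fubini_integral[OF f_integrable])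
  also have "\<dots> = (\<integral>p. g (fst p) * g (snd p) * min (fst p) (snd p) \<partial>P)"
    by (intro Bochner_Integration.integral_cong f_exp) auto
  also have "\<dots> = integral {0..T} (\<lambda>s. integral {0..T} (\<lambda>r. g s * g r * min s r))"
    unfolding P_def I_def
    by (subst interval_measure_pair_integral)
      (auto intro!: continuous_intros continuous_on_compose2[OF g])
  finally show "expectation (\<lambda>\<omega>. (X \<omega>)\<^sup>2)
      = integral {0..T} (\<lambda>s. integral {0..T} (\<lambda>r. g s * g r * min s r))" .
qed

section \<open>The stationary variance of one mode\<close>

text \<open>
  The state is a transient, linear in the initial state, plus a noise integral. The transient
  and its correlation with the noise vanish in the limit because \<open>h\<close> and \<open>h'\<close> decay while the
  second moments of the noise integral stay bounded. The noise integral has variance \<open>\<integral> h\<^sup>2\<close>.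
\<close>

lemma (in prob_space) mode_variance:
  fixes a b w :: "real \<Rightarrow> 'a \<Rightarrow> real"
  assumes l: "l > 0" and d: "d > 0"
    and w_meas: "\<And>t. 0 \<le> t \<Longrightarrow> w t \<in> borel_measurable M"
    and w_sq: "\<And>t. 0 \<le> t \<Longrightarrow> integrable M (\<lambda>\<omega>. (w t \<omega>)\<^sup>2)"
    and w_cov: "\<And>s t. 0 \<le> s \<Longrightarrow> 0 \<le> t \<Longrightarrow> expectation (\<lambda>\<omega>. w s \<omega> * w t \<omega>) = min s t"
    and a_meas: "\<And>t. 0 \<le> t \<Longrightarrow> a t \<in> borel_measurable M"
    and b_meas: "b 0 \<in> borel_measurable M"
    and init: "integrable M (\<lambda>\<omega>. (a 0 \<omega>)\<^sup>2)" "integrable M (\<lambda>\<omega>. (b 0 \<omega>)\<^sup>2)"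
    and cont: "AE \<omega> in M. continuous_on {0..} (\<lambda>t. a t \<omega>) \<and> continuous_on {0..} (\<lambda>t. b t \<omega>) \<and>
      continuous_on {0..} (\<lambda>t. w t \<omega>)"
    and dyn: "AE \<omega> in M. \<forall>t\<ge>0. a t \<omega> = a 0 \<omega> + integral {0..t} (\<lambda>s. b s \<omega>) \<and>
      b t \<omega> = b 0 \<omega> - integral {0..t} (\<lambda>s. l * a s \<omega> + d * b s \<omega>) + w t \<omega>"
  shows "0 \<le> t \<Longrightarrow> integrable M (\<lambda>\<omega>. (a t \<omega>)\<^sup>2)"
    and "((\<lambda>t. expectation (\<lambda>\<omega>. (a t \<omega>)\<^sup>2)) \<longlongrightarrow> 1 / (2 * l * d)) at_top"
proof -
  obtain h h' where "impulse_response l d h h'" using impulse_response_exists[OF l d] by blast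
  then interpret impulse_response l d h h' .
  have [measurable]: "a 0 \<in> borel_measurable M" "b 0 \<in> borel_measurable M"
    using a_meas b_meas by auto
  define k where "k t = h' t + d * h t" for t
  define I where "I t \<omega> = h t * b 0 \<omega> + k t * a 0 \<omega>" for t \<omega>
  define N where "N t \<omega> = a t \<omega> - I t \<omega>" for t \<omega>
  define V where "V t = integral {0..t} (\<lambda>s. (h (t - s))\<^sup>2)" for t
  have N_meas[measurable]: "N t \<in> borel_measurable M" if "0 \<le> t" for t
    using a_meas[OF that] unfolding N_def I_def by measurable
  have N_eq: "AE \<omega> in M. N t \<omega> = integral {0..t} (\<lambda>s. h' (t - s) * w s \<omega>)" if t: "0 \<le> t" for t
    using cont dyn
  proof eventually_elim
    case (elim \<omega>)
    have dyn': "a s \<omega> = a 0 \<omega> + integral {0..s} (\<lambda>s. b s \<omega>)"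
      "b s \<omega> = b 0 \<omega> - integral {0..s} (\<lambda>s. l * a s \<omega> + d * b s \<omega>) + w s \<omega>"
      if "s \<in> {0..t}" for s
      using elim(2) that by (meson atLeastAtMost_iff)+
    have "a t \<omega> = h t * b 0 \<omega> + (h' t + d * h t) * a 0 \<omega> + integral {0..t} (\<lambda>s. h' (t - s) * w s \<omega>)"
    proof (rule variation_of_constants[OF t, where b = "\<lambda>t. b t \<omega>" and a = "\<lambda>t. a t \<omega>"])
      show "continuous_on {0..t} (\<lambda>t. a t \<omega>)" "continuous_on {0..t} (\<lambda>t. b t \<omega>)"
        "continuous_on {0..t} (\<lambda>t. w t \<omega>)"
        using elim(1) by (auto intro: continuous_on_subset)
    qed (rule dyn', assumption)+
    then show ?case by (simp add: N_def I_def k_def)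
  qed
  have cw: "AE \<omega> in M. continuous_on {0..} (\<lambda>t. w t \<omega>)" using cont by eventually_elim simp
  have g: "continuous_on UNIV (\<lambda>s. h' (t - s))" for t
    by (intro continuous_on_compose2[OF h'_cont] continuous_intros) auto
  have N_sq: "integrable M (\<lambda>\<omega>. (N t \<omega>)\<^sup>2)" if t: "0 \<le> t" for t
    by (rule second_moment_noise_integral(1)[OF w_meas w_sq cw w_cov t g N_meas N_eq]) (use t in auto)
  have N_var: "expectation (\<lambda>\<omega>. (N t \<omega>)\<^sup>2) = V t" if t: "0 \<le> t" for t
  proof -
    have "expectation (\<lambda>\<omega>. (N t \<omega>)\<^sup>2)
        = integral {0..t} (\<lambda>s. integral {0..t} (\<lambda>r. h' (t - s) * h' (t - r) * min s r))"
      by (rule second_moment_noise_integral(2)[OF w_meas w_sq cw w_cov t g N_meas N_eq]) (use t in auto)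
    also have "\<dots> = V t"
      unfolding V_def
    proof (rule min_kernel_integral[OF t g])
      show "((\<lambda>s. h (t - s)) has_real_derivative - h' (t - s)) (at s)" for s
        using DERIV_chain2[OF h_deriv DERIV_diff[OF DERIV_const DERIV_ident], of t s UNIV] by simp
    qed (simp add: h_0)
    finally show ?thesis .
  qed
  have V_lim: "(V \<longlongrightarrow> 1 / (2 * l * d)) at_top" unfolding V_def by (rule energy)
  have k_lim: "(k \<longlongrightarrow> 0) at_top"
    unfolding k_def using tendsto_add[OF decay(2) tendsto_mult_right_zero[OF decay(1), of d]] by simp
  define A where "A = expectation (\<lambda>\<omega>. (a 0 \<omega>)\<^sup>2)"
  define B where "B = expectation (\<lambda>\<omega>. (b 0 \<omega>)\<^sup>2)"
  define D where "D = expectation (\<lambda>\<omega>. a 0 \<omega> * b 0 \<omega>)"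
  define R where "R t = 2 * h t * expectation (\<lambda>\<omega>. b 0 \<omega> * N t \<omega>)
    + 2 * k t * expectation (\<lambda>\<omega>. a 0 \<omega> * N t \<omega>)" for t
  note aN = integrable_mult_square_integrable[OF _ N_meas init(1) N_sq]
  note bN = integrable_mult_square_integrable[OF _ N_meas init(2) N_sq]
  note ab = integrable_mult_square_integrable(1)[OF _ _ init]
  have a_sq: "(\<lambda>\<omega>. (a t \<omega>)\<^sup>2) = (\<lambda>\<omega>. (h t)\<^sup>2 * (b 0 \<omega>)\<^sup>2 + 2 * h t * k t * (a 0 \<omega> * b 0 \<omega>) + (k t)\<^sup>2 * (a 0 \<omega>)\<^sup>2
      + (2 * h t * (b 0 \<omega> * N t \<omega>) + 2 * k t * (a 0 \<omega> * N t \<omega>)) + (N t \<omega>)\<^sup>2)" for t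
  proof
    fix \<omega>
    have "a t \<omega> = h t * b 0 \<omega> + k t * a 0 \<omega> + N t \<omega>" by (simp add: N_def I_def)
    then show "(a t \<omega>)\<^sup>2 = (h t)\<^sup>2 * (b 0 \<omega>)\<^sup>2 + 2 * h t * k t * (a 0 \<omega> * b 0 \<omega>) + (k t)\<^sup>2 * (a 0 \<omega>)\<^sup>2
      + (2 * h t * (b 0 \<omega> * N t \<omega>) + 2 * k t * (a 0 \<omega> * N t \<omega>)) + (N t \<omega>)\<^sup>2" by (simp add: power2_eq_square algebra_simps)
  qed
  show "integrable M (\<lambda>\<omega>. (a t \<omega>)\<^sup>2)" if "0 \<le> t" for t
    using that init ab aN(1) bN(1) N_sq by (subst a_sq) simp
  have a_var: "expectation (\<lambda>\<omega>. (a t \<omega>)\<^sup>2)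
      = (h t)\<^sup>2 * B + 2 * h t * k t * D + (k t)\<^sup>2 * A + R t + V t" if t: "0 \<le> t" for t
    using t init ab aN(1) bN(1) N_sq N_var
    by (subst a_sq) (simp add: A_def B_def D_def R_def)
  have R_lim: "(R \<longlongrightarrow> 0) at_top"
  proof (rule Lim_null_comparison)
    show "\<forall>\<^sub>F t in at_top. norm (R t) \<le> \<bar>h t\<bar> * (B + V t) + \<bar>k t\<bar> * (A + V t)"
      using eventually_ge_at_top[of 0]
    proof eventually_elim
      case (elim t)
      have 1: "2 * \<bar>expectation (\<lambda>\<omega>. b 0 \<omega> * N t \<omega>)\<bar> \<le> B + V t"
        using order_trans[OF integral_abs_bound bN(2)[of t]] elim by (simp add: B_def N_var)
      have 2: "2 * \<bar>expectation (\<lambda>\<omega>. a 0 \<omega> * N t \<omega>)\<bar> \<le> A + V t"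
        using order_trans[OF integral_abs_bound aN(2)[of t]] elim by (simp add: A_def N_var)
      have "norm (R t) \<le> \<bar>h t\<bar> * (2 * \<bar>expectation (\<lambda>\<omega>. b 0 \<omega> * N t \<omega>)\<bar>)
          + \<bar>k t\<bar> * (2 * \<bar>expectation (\<lambda>\<omega>. a 0 \<omega> * N t \<omega>)\<bar>)"
        unfolding R_def real_norm_def by (rule order_trans[OF abs_triangle_ineq]) (simp add: abs_mult)
      also have "\<dots> \<le> \<bar>h t\<bar> * (B + V t) + \<bar>k t\<bar> * (A + V t)"
        using 1 2 by (intro add_mono mult_left_mono) auto
      finally show ?case .
    qed
    have "((\<lambda>t. \<bar>h t\<bar> * (B + V t) + \<bar>k t\<bar> * (A + V t)) \<longlongrightarrow>
        \<bar>0\<bar> * (B + 1 / (2 * l * d)) + \<bar>0\<bar> * (A + 1 / (2 * l * d))) at_top"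
      by (intro tendsto_intros decay k_lim V_lim)
    then show "((\<lambda>t. \<bar>h t\<bar> * (B + V t) + \<bar>k t\<bar> * (A + V t)) \<longlongrightarrow> 0) at_top" by simp
  qed
  have "((\<lambda>t. (h t)\<^sup>2 * B + 2 * h t * k t * D + (k t)\<^sup>2 * A + R t + V t) \<longlongrightarrow>
      0\<^sup>2 * B + 2 * 0 * 0 * D + 0\<^sup>2 * A + 0 + 1 / (2 * l * d)) at_top"
    by (intro tendsto_intros decay k_lim V_lim R_lim)
  then have "((\<lambda>t. (h t)\<^sup>2 * B + 2 * h t * k t * D + (k t)\<^sup>2 * A + R t + V t) \<longlongrightarrow>
      1 / (2 * l * d)) at_top" by simp
  then show "((\<lambda>t. expectation (\<lambda>\<omega>. (a t \<omega>)\<^sup>2)) \<longlongrightarrow> 1 / (2 * l * d)) at_top"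
    by (rule Lim_transform_eventually)
      (rule eventually_mono[OF eventually_ge_at_top[of 0]], simp add: a_var)
qed

section \<open>Decoupling the network into modes\<close>

definition position_vector :: "real^'n::finite \<Rightarrow> real^('n + 'n)" where
  "position_vector q = (\<chi> i. case i of Inl k \<Rightarrow> q $ k | Inr k \<Rightarrow> 0)"

definition velocity_vector :: "real^'n::finite \<Rightarrow> real^('n + 'n)" where
  "velocity_vector q = (\<chi> i. case i of Inl k \<Rightarrow> 0 | Inr k \<Rightarrow> q $ k)"

lemma sum_UNIV_Plus:
  fixes f :: "'a::finite + 'b::finite \<Rightarrow> 'c::comm_monoid_add"
  shows "sum f UNIV = (\<Sum>k\<in>UNIV. f (Inl k)) + (\<Sum>k\<in>UNIV. f (Inr k))"
  by (simp flip: UNIV_Plus_UNIV add: sum.Plus)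

lemma position_vector_inner: "position_vector q \<bullet> z = (\<Sum>k\<in>UNIV. q $ k * z $ Inl k)"
  and velocity_vector_inner: "velocity_vector q \<bullet> z = (\<Sum>k\<in>UNIV. q $ k * z $ Inr k)"
  by (simp_all add: inner_vec_def position_vector_def velocity_vector_def sum_UNIV_Plus)

lemma state_matrix_Inl: "(type2_state_matrix G \<beta> *v z) $ Inl k = - z $ Inr k"
  by (simp add: type2_state_matrix_def block_matrix_def matrix_vector_mult_def sum_UNIV_Plus
      mat_def if_distrib[of "\<lambda>x. x * _"] if_distrib[of uminus] cong: if_cong)

lemma state_matrix_Inr:
  "(type2_state_matrix G \<beta> *v z) $ Inr k
     = (laplacian G *v (\<chi> j. z $ Inl j)) $ k + \<beta> * (laplacian G *v (\<chi> j. z $ Inr j)) $ k"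
  by (simp add: type2_state_matrix_def block_matrix_def matrix_vector_mult_def sum_UNIV_Plus
      sum_distrib_left mult.assoc)

lemma position_state_matrix:
  "position_vector q \<bullet> (type2_state_matrix G \<beta> *v z) = - (velocity_vector q \<bullet> z)"
  by (simp add: position_vector_inner velocity_vector_inner state_matrix_Inl sum_negf)

lemma velocity_state_matrix:
  assumes sym: "\<And>x y. (laplacian G *v x) \<bullet> y = x \<bullet> (laplacian G *v y)"
    and eig: "laplacian G *v q = \<mu> *\<^sub>R q"
  shows "velocity_vector q \<bullet> (type2_state_matrix G \<beta> *v z)
    = \<mu> * (position_vector q \<bullet> z) + \<beta> * \<mu> * (velocity_vector q \<bullet> z)"
proof -
  have L: "q \<bullet> (laplacian G *v x) = \<mu> * (q \<bullet> x)" for x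
    using sym[of q x] eig by simp
  have "velocity_vector q \<bullet> (type2_state_matrix G \<beta> *v z)
      = q \<bullet> (laplacian G *v (\<chi> j. z $ Inl j)) + \<beta> * (q \<bullet> (laplacian G *v (\<chi> j. z $ Inr j)))"
    unfolding velocity_vector_inner state_matrix_Inr
    by (simp add: inner_vec_def sum.distrib sum_distrib_left algebra_simps)
  also have "\<dots> = \<mu> * (position_vector q \<bullet> z) + \<beta> * \<mu> * (velocity_vector q \<bullet> z)"
    unfolding L position_vector_inner velocity_vector_inner by (simp add: inner_vec_def)
  finally show ?thesis .
qed

lemma position_input_matrix: "position_vector q \<bullet> (type2_input_matrix *v x) = 0"
  by (simp add: position_vector_inner type2_input_matrix_def matrix_vector_mult_def)

lemma velocity_input_matrix: "velocity_vector q \<bullet> (type2_input_matrix *v x) = q \<bullet> x"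
  unfolding velocity_vector_inner
  by (simp add: type2_input_matrix_def matrix_vector_mult_def mat_def
      inner_vec_def if_distrib[of "\<lambda>x. x * _"] cong: if_cong)

lemma centering_matrix_mult:
  fixes x :: "real^'n::finite"
  shows "centering_matrix *v x = x - ((1 \<bullet> x) / real CARD('n)) *\<^sub>R 1"
  by (simp add: vec_eq_iff centering_matrix_def matrix_vector_mult_def mat_def inner_vec_def
      left_diff_distrib sum_subtractf if_distrib[of "\<lambda>x. x * _"] sum_divide_distrib cong: if_cong)

lemma output_norm:
  fixes z :: "real^('n::finite + 'n)"
  shows "(direct_sum centering_matrix (0 :: real^'n^'n) *v z) \<bullet> (direct_sum centering_matrix (0 :: real^'n^'n) *v z)
    = (centering_matrix *v (\<chi> k. z $ Inl k)) \<bullet> (centering_matrix *v (\<chi> k. z $ Inl k))"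
  by (simp add: direct_sum_def block_matrix_def inner_vec_def matrix_vector_mult_def sum_UNIV_Plus)

text \<open>
  Centering removes the constant mode, the only one that is not asymptotically stable.
\<close>

lemma output_modes:
  fixes z :: "real^('n::finite + 'n)" and Q :: "(real^'n) set"
  assumes Q: "pairwise orthogonal Q" "\<And>q. q \<in> Q \<Longrightarrow> norm q = 1" "span Q = {x. 1 \<bullet> x = 0}"
  shows "(direct_sum centering_matrix (0 :: real^'n^'n) *v z) \<bullet> (direct_sum centering_matrix (0 :: real^'n^'n) *v z)
    = (\<Sum>q\<in>Q. (position_vector q \<bullet> z)\<^sup>2)"
proof -
  define x where "x = (\<chi> k. z $ Inl k)"
  define y where "y = centering_matrix *v x"
  have "1 \<bullet> (1 :: real^'n) = real CARD('n)" by (simp add: inner_vec_def)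
  then have "1 \<bullet> y = 0" by (simp add: y_def centering_matrix_mult inner_diff_right)
  then have "y \<in> span Q" by (simp add: Q(3))
  then have exp: "y = (\<Sum>q\<in>Q. (q \<bullet> y) *\<^sub>R q)" by (intro orthonormal_expansion Q)
  have "q \<bullet> y = position_vector q \<bullet> z" if "q \<in> Q" for q
  proof -
    have "1 \<bullet> q = 0" using Q(3) span_base[OF that] by blast
    then have "q \<bullet> y = q \<bullet> x" by (simp add: y_def centering_matrix_mult inner_diff_right inner_commute)
    then show ?thesis unfolding position_vector_inner by (simp add: inner_vec_def x_def)
  qed
  moreover have "y \<bullet> y = (\<Sum>q\<in>Q. (q \<bullet> y) * (q \<bullet> y))"
    by (subst (2) exp) (simp add: inner_sum_right inner_commute)
  ultimately show ?thesis
    by (simp add: output_norm power2_eq_square flip: x_def y_def)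
qed

lemma mode_dynamics:
  fixes \<psi> :: "real \<Rightarrow> real^('n::finite + 'n)" and w :: "real \<Rightarrow> real^'n"
  assumes cont: "continuous_on {0..} \<psi>"
    and eq: "\<forall>t\<ge>0. \<psi> t = \<psi> 0 - integral {0..t} (\<lambda>s. type2_state_matrix G \<beta> *v \<psi> s) + type2_input_matrix *v w t"
    and sym: "\<And>x y. (laplacian G *v x) \<bullet> y = x \<bullet> (laplacian G *v y)"
    and eig: "laplacian G *v q = \<mu> *\<^sub>R q" and t: "0 \<le> t"
  shows "position_vector q \<bullet> \<psi> t = position_vector q \<bullet> \<psi> 0 + integral {0..t} (\<lambda>s. velocity_vector q \<bullet> \<psi> s)"
    and "velocity_vector q \<bullet> \<psi> t = velocity_vector q \<bullet> \<psi> 0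
      - integral {0..t} (\<lambda>s. \<mu> * (position_vector q \<bullet> \<psi> s) + \<beta> * \<mu> * (velocity_vector q \<bullet> \<psi> s)) + q \<bullet> w t"
proof -
  have "continuous_on {0..t} (\<lambda>s. type2_state_matrix G \<beta> *v \<psi> s)"
    by (rule continuous_on_compose2[OF linear_continuous_on[OF matrix_vector_mul_bounded_linear]
          continuous_on_subset[OF cont]]) auto
  then have int: "(\<lambda>s. type2_state_matrix G \<beta> *v \<psi> s) integrable_on {0..t}"
    by (rule integrable_continuous_real)
  have inner: "c \<bullet> integral {0..t} (\<lambda>s. type2_state_matrix G \<beta> *v \<psi> s)
      = integral {0..t} (\<lambda>s. c \<bullet> (type2_state_matrix G \<beta> *v \<psi> s))" for c
    using integral_linear[OF int bounded_linear_inner_right[of c]] by (simp add: o_def)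
  have eq_t: "\<psi> t = \<psi> 0 - integral {0..t} (\<lambda>s. type2_state_matrix G \<beta> *v \<psi> s) + type2_input_matrix *v w t"
    using eq t by blast
  show "position_vector q \<bullet> \<psi> t = position_vector q \<bullet> \<psi> 0 + integral {0..t} (\<lambda>s. velocity_vector q \<bullet> \<psi> s)"
    by (subst eq_t) (simp add: inner_add_right inner_diff_right inner position_state_matrix position_input_matrix)
  show "velocity_vector q \<bullet> \<psi> t = velocity_vector q \<bullet> \<psi> 0
      - integral {0..t} (\<lambda>s. \<mu> * (position_vector q \<bullet> \<psi> s) + \<beta> * \<mu> * (velocity_vector q \<bullet> \<psi> s)) + q \<bullet> w t"
    by (subst eq_t) (simp add: inner_add_right inner_diff_right inner velocity_state_matrix[OF sym eig]
        velocity_input_matrix)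
qed

lemma white_noise_projection:
  fixes q :: "real^'n::finite"
  assumes W: "integrated_white_noise M W" and q: "norm q = 1"
  shows "0 \<le> t \<Longrightarrow> (\<lambda>\<omega>. q \<bullet> W t \<omega>) \<in> borel_measurable M"
    and "0 \<le> t \<Longrightarrow> integrable M (\<lambda>\<omega>. (q \<bullet> W t \<omega>)\<^sup>2)"
    and "0 \<le> s \<Longrightarrow> 0 \<le> t \<Longrightarrow> (\<integral>\<omega>. (q \<bullet> W s \<omega>) * (q \<bullet> W t \<omega>) \<partial>M) = min s t"
proof -
  have meas: "W t \<in> borel_measurable M" and sq: "integrable M (\<lambda>\<omega>. (norm (W t \<omega>))\<^sup>2)"
    if "0 \<le> t" for t using W that by (auto simp: integrated_white_noise_def)
  show qm: "(\<lambda>\<omega>. q \<bullet> W t \<omega>) \<in> borel_measurable M" if "0 \<le> t" for t and q :: "real^'n"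
    using meas[OF that] by simp
  show qs: "integrable M (\<lambda>\<omega>. (q \<bullet> W t \<omega>)\<^sup>2)" if "0 \<le> t" for t and q :: "real^'n"
  proof (rule Bochner_Integration.integrable_bound)
    show "integrable M (\<lambda>\<omega>. (norm q)\<^sup>2 * (norm (W t \<omega>))\<^sup>2)" using sq[OF that] by simp
    show "AE \<omega> in M. norm ((q \<bullet> W t \<omega>)\<^sup>2) \<le> norm ((norm q)\<^sup>2 * (norm (W t \<omega>))\<^sup>2)"
      using power_mono[OF Cauchy_Schwarz_ineq2 abs_ge_zero, of q _ 2]
      by (intro AE_I2) (simp add: power_mult_distrib)
  qed (use qm[OF that] in measurable)
  show "(\<integral>\<omega>. (q \<bullet> W s \<omega>) * (q \<bullet> W t \<omega>) \<partial>M) = min s t" if st: "0 \<le> s" "0 \<le> t" for s t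
  proof -
    have comp: "(\<lambda>\<omega>. W t \<omega> $ i) = (\<lambda>\<omega>. axis i 1 \<bullet> W t \<omega>)" for t i by (simp add: inner_axis')
    have int: "integrable M (\<lambda>\<omega>. W s \<omega> $ i * W t \<omega> $ j)" for i j
      using integrable_mult_square_integrable(1)[OF qm[OF st(1), of "axis i 1"] qm[OF st(2), of "axis j 1"]
          qs[OF st(1)] qs[OF st(2)]] by (simp add: inner_axis')
    have cov: "(\<integral>\<omega>. W s \<omega> $ i * W t \<omega> $ j \<partial>M) = (if i = j then min s t else 0)" for i j
      using W st by (simp add: integrated_white_noise_def)
    have "(q \<bullet> W s \<omega>) * (q \<bullet> W t \<omega>) = (\<Sum>i\<in>UNIV. \<Sum>j\<in>UNIV. q $ i * q $ j * (W s \<omega> $ i * W t \<omega> $ j))" for \<omega>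
      by (simp add: inner_vec_def sum_product algebra_simps)
    then have "(\<integral>\<omega>. (q \<bullet> W s \<omega>) * (q \<bullet> W t \<omega>) \<partial>M)
        = (\<Sum>i\<in>UNIV. \<Sum>j\<in>UNIV. q $ i * q $ j * (if i = j then min s t else 0))"
      using int by (simp add: cov)
    also have "\<dots> = (q \<bullet> q) * min s t"
      by (simp add: inner_vec_def sum_distrib_right if_distrib[of "\<lambda>x. _ * x"] cong: if_cong)
    also have "q \<bullet> q = 1" using q by (simp add: dot_square_norm)
    finally show ?thesis by simp
  qed
qed

text \<open>
  Each eigenvector \<open>q\<close> with eigenvalue \<open>\<lambda>\<close> gives an oscillator with stiffness \<open>\<lambda>\<close> and damping \<open>\<beta> \<lambda>\<close>,
  hence the limit variance \<open>1 / (2 \<beta> \<lambda>\<^sup>2)\<close>; the output variance is the sum over the modes.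
\<close>

theorem type2_output_variance_tendsto:
  fixes Q :: "(real^'n::finite) set" and ev :: "real^'n \<Rightarrow> real"
  assumes \<beta>: "\<beta> > 0" and net: "type2_network M G \<beta> W \<psi>"
    and sym: "\<And>x y. (laplacian G *v x) \<bullet> y = x \<bullet> (laplacian G *v y)"
    and Q: "pairwise orthogonal Q" "\<And>q. q \<in> Q \<Longrightarrow> norm q = 1" "span Q = {x. 1 \<bullet> x = 0}"
    and eig: "\<And>q. q \<in> Q \<Longrightarrow> laplacian G *v q = ev q *\<^sub>R q" and pos: "\<And>q. q \<in> Q \<Longrightarrow> 0 < ev q"
  shows "(output_variance M (direct_sum centering_matrix (0 :: real^'n^'n)) \<psi> \<longlongrightarrow>
    1 / (2 * \<beta>) * (\<Sum>q\<in>Q. 1 / (ev q)\<^sup>2)) at_top"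
proof -
  have W: "integrated_white_noise M W"
    and meas: "\<And>t. 0 \<le> t \<Longrightarrow> \<psi> t \<in> borel_measurable M"
    and init: "integrable M (\<lambda>\<omega>. (norm (\<psi> 0 \<omega>))\<^sup>2)"
    and path: "AE \<omega> in M. continuous_on {0..} (\<lambda>t. \<psi> t \<omega>) \<and>
      (\<forall>t\<ge>0. \<psi> t \<omega> = \<psi> 0 \<omega> - integral {0..t} (\<lambda>s. type2_state_matrix G \<beta> *v \<psi> s \<omega>)
        + type2_input_matrix *v W t \<omega>)"
    using net by (auto simp: type2_network_def noisy_linear_system_def)
  have modes: "(direct_sum centering_matrix (0 :: real^'n^'n) *v z) \<bullet> (direct_sum centering_matrix (0 :: real^'n^'n) *v z)
      = (\<Sum>q\<in>Q. (position_vector q \<bullet> z)\<^sup>2)" for z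
    by (intro output_modes Q)
  interpret prob_space M using W by (simp add: integrated_white_noise_def)
  have W_cont: "AE \<omega> in M. continuous_on {0..} (\<lambda>t. W t \<omega>)"
    using W by (simp add: integrated_white_noise_def)
  have init_c: "integrable M (\<lambda>\<omega>. (c \<bullet> \<psi> 0 \<omega>)\<^sup>2)" for c
  proof (rule Bochner_Integration.integrable_bound)
    show "integrable M (\<lambda>\<omega>. (norm c)\<^sup>2 * (norm (\<psi> 0 \<omega>))\<^sup>2)" using init by simp
    show "AE \<omega> in M. norm ((c \<bullet> \<psi> 0 \<omega>)\<^sup>2) \<le> norm ((norm c)\<^sup>2 * (norm (\<psi> 0 \<omega>))\<^sup>2)"
      using power_mono[OF Cauchy_Schwarz_ineq2 abs_ge_zero, of c _ 2]
      by (intro AE_I2) (simp add: power_mult_distrib)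
  qed (use meas[of 0] in measurable)
  have mode: "(\<forall>t\<ge>0. integrable M (\<lambda>\<omega>. (position_vector q \<bullet> \<psi> t \<omega>)\<^sup>2)) \<and>
      ((\<lambda>t. expectation (\<lambda>\<omega>. (position_vector q \<bullet> \<psi> t \<omega>)\<^sup>2)) \<longlongrightarrow> 1 / (2 * \<beta>) * (1 / (ev q)\<^sup>2)) at_top"
    if q: "q \<in> Q" for q
  proof -
    have d: "0 < \<beta> * ev q" using \<beta> pos[OF q] by simp
    have cont: "AE \<omega> in M. continuous_on {0..} (\<lambda>t. position_vector q \<bullet> \<psi> t \<omega>) \<and>
        continuous_on {0..} (\<lambda>t. velocity_vector q \<bullet> \<psi> t \<omega>) \<and> continuous_on {0..} (\<lambda>t. q \<bullet> W t \<omega>)"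
      using path W_cont by eventually_elim (auto intro!: continuous_intros)
    have dyn: "AE \<omega> in M. \<forall>t\<ge>0.
        position_vector q \<bullet> \<psi> t \<omega> = position_vector q \<bullet> \<psi> 0 \<omega> + integral {0..t} (\<lambda>s. velocity_vector q \<bullet> \<psi> s \<omega>) \<and>
        velocity_vector q \<bullet> \<psi> t \<omega> = velocity_vector q \<bullet> \<psi> 0 \<omega>
          - integral {0..t} (\<lambda>s. ev q * (position_vector q \<bullet> \<psi> s \<omega>) + \<beta> * ev q * (velocity_vector q \<bullet> \<psi> s \<omega>)) + q \<bullet> W t \<omega>"
      using path
    proof eventually_elim
      case (elim \<omega>)
      then show ?case
        using mode_dynamics[of "\<lambda>t. \<psi> t \<omega>" G \<beta> "\<lambda>t. W t \<omega>", OF _ _ sym eig[OF q]] by blast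
    qed
    have meas': "(\<lambda>\<omega>. c \<bullet> \<psi> t \<omega>) \<in> borel_measurable M" if "0 \<le> t" for c t
      using meas[OF that] by simp
    note mv = mode_variance[OF pos[OF q] d white_noise_projection[OF W Q(2)[OF q]] meas' meas'[OF order_refl]
        init_c init_c cont dyn]
    have "1 / (2 * ev q * (\<beta> * ev q)) = 1 / (2 * \<beta>) * (1 / (ev q)\<^sup>2)"
      by (simp add: power2_eq_square)
    with mv show ?thesis by simp
  qed
  have "((\<lambda>t. \<Sum>q\<in>Q. expectation (\<lambda>\<omega>. (position_vector q \<bullet> \<psi> t \<omega>)\<^sup>2)) \<longlongrightarrow>
      (\<Sum>q\<in>Q. 1 / (2 * \<beta>) * (1 / (ev q)\<^sup>2))) at_top"
    using mode by (intro tendsto_sum) blast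
  moreover have "\<forall>\<^sub>F t in at_top. (\<Sum>q\<in>Q. expectation (\<lambda>\<omega>. (position_vector q \<bullet> \<psi> t \<omega>)\<^sup>2))
      = output_variance M (direct_sum centering_matrix (0 :: real^'n^'n)) \<psi> t"
    using eventually_ge_at_top[of 0]
  proof eventually_elim
    case (elim t)
    then show ?case
      using mode unfolding output_variance_def modes
      by (intro Bochner_Integration.integral_sum[symmetric]) blast
  qed
  ultimately show ?thesis
    unfolding sum_distrib_left by (rule Lim_transform_eventually)
qed

section \<open>Bounds on the performance measure\<close>

theorem theorem7:
  fixes G :: "'n::finite pair_pre_digraph"
    and \<beta> \<rho> :: real
    and n :: nat
    and M :: "'w measure"
    and W :: "real \<Rightarrow> 'w \<Rightarrow> real^'n"
    and \<psi> :: "real \<Rightarrow> 'w \<Rightarrow> real^('n + 'n)"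
  assumes "pair_graph G" and "pverts G = UNIV" and "Digraph_Component.connected (with_proj G)"
    and "n = CARD('n)"
    and "\<beta> > 0"
    and "type2_network M G \<beta> W \<psi>"
    and "\<rho> = steady_state_variance M (direct_sum centering_matrix (0 :: real^'n^'n)) \<psi>"
  shows "(output_variance M (direct_sum centering_matrix (0 :: real^'n^'n)) \<psi> \<longlongrightarrow> \<rho>) at_top \<and>
    1 / \<beta> * (1 / (2 * real n) - 1 / (2 * (real n)\<^sup>2)) \<le> \<rho> \<and>
    \<rho> \<le> Xi \<beta> n \<and>
    (\<not> (n \<le> 4 \<and> path_graph G) \<longrightarrow> \<rho> < Xi \<beta> n) \<and>
    (\<rho> = 1 / \<beta> * (1 / (2 * real n) - 1 / (2 * (real n)\<^sup>2)) \<longleftrightarrow> complete_digraph n (with_proj G))"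
proof -
  have n: "real n = real CARD('n)" and n_pos: "real n > 0" using assms(4) by simp_all
  interpret connected_network G using assms(1-3) by (rule connected_network.intro)
  obtain Q where "pairwise orthogonal Q" "\<forall>q\<in>Q. norm q = 1" "span Q = {x :: real^'n. 1 \<bullet> x = 0}"
    "\<forall>q\<in>Q. laplacian G *v q = (q \<bullet> (laplacian G *v q)) *\<^sub>R q"
    using laplacian_eigenbasis by blast
  then interpret diagonalised_network G Q by unfold_locales blast+
  define S where "S = inverse_square_sum"
  have lim: "(output_variance M (direct_sum centering_matrix (0 :: real^'n^'n)) \<psi> \<longlongrightarrow> 1 / (2 * \<beta>) * S) at_top"
    unfolding S_def
    by (rule type2_output_variance_tendsto[OF assms(5,6) laplacian_self_adjoint orth unit span_Q eig ev_pos])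
  have \<rho>: "\<rho> = 1 / (2 * \<beta>) * S"
    unfolding assms(7) steady_state_variance_def by (rule tendsto_Lim[OF _ lim]) simp
  have c: "0 < 1 / (2 * \<beta>)" using assms(5) by simp
  have Xi: "Xi \<beta> n = 1 / (2 * \<beta>) * path_bound (real n)"
    using assms(5) n_pos by (simp add: Xi_def path_bound_def field_simps power2_eq_square)
  have low: "1 / \<beta> * (1 / (2 * real n) - 1 / (2 * (real n)\<^sup>2)) = 1 / (2 * \<beta>) * ((real n - 1) / (real n)\<^sup>2)"
    using assms(5) n_pos by (simp add: field_simps power2_eq_square)
  have complete: "complete_digraph n (with_proj G) \<longleftrightarrow> parcs G = {(u, v). u \<noteq> v}"
    using assms(2,4) by (simp add: complete_digraph_pair_def)
  have strict: "S < path_bound (real n)" if "\<not> (n \<le> 4 \<and> path_graph G)"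
  proof -
    have "S \<noteq> path_bound (real n)"
      using that inverse_square_sum_extremal assms(4) unfolding S_def by auto
    then show ?thesis using inverse_square_sum_le_path_bound unfolding S_def n by simp
  qed
  have lower: "(real n - 1) / (real n)\<^sup>2 \<le> S"
    using inverse_square_sum_ge unfolding S_def n .
  have upper: "S \<le> path_bound (real n)"
    using inverse_square_sum_le_path_bound unfolding S_def n .
  have equality: "S = (real n - 1) / (real n)\<^sup>2 \<longleftrightarrow> parcs G = {(u, v). u \<noteq> v}"
    using inverse_square_sum_minimal_iff unfolding S_def n .
  show ?thesis
    unfolding low Xi complete equality[symmetric]
    using lim lower upper strict
    by (simp only: \<rho> mult_le_cancel_left_pos[OF c] mult_less_cancel_left_pos[OF c]
        mult_cancel_left less_imp_neq[OF c, symmetric] simp_thms) simp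
qed

end
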